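(* Let $(a,F)$ be a game with associated measure $\rho$ on $(0,\infty)$. Suppose $E<\infty$ and $\lim_{m\to E^-}u_{\max}'(m)$ exists (derivative with respect to $m$). Then there is a number $r$ with $0\le r\le1$ such that $$\lim_{m\to E^-}\frac{u_{\max}(m)}{E-m}=\frac{1-r}{2-r},$$ the function $x\mapsto\int_0^x\rho(dt)$ is regularly varying of index $r$, and for every $n>1$, $r$ is the upper order of the function $x\mapsto\int_0^\infty\left(\frac{x}{x+t}\right)^n\rho(dt)$.
   Context: A game is a pair $(a,F)$, where $F$ is a probability distribution function on an interval $I\subseteq\mathbb{R}$ (so $\int_I dF=1$) and $a:I\to\mathbb{R}$ is measurable and not constant $F$-almost everywhere. Put $E=\int_I a(x)\,dF$, $\xi=\operatorname{ess\,inf}_{x\in I}a(x)$ (with respect to $F$), and $H_\xi=\int_I \frac{1}{a(x)-\xi}\,dF\in(0,\infty]$, where $H_\xi=\infty$ if $\int_{a(x)=\xi}dF>0$, and $1/H_\xi=0$ if $H_\xi=\infty$. Standing assumptions: $E>0$ and $\xi>-\infty$. One has $\xi+1/H_\xi<E$. Define $\Psi(c)=1/\int_I (a(x)+c)^{-1}dF-c$ for $c>-\xi$. For $m\in(\xi+1/H_\xi,E)$ and $0<u<E-m$, the optimal proportion of investment at price $u$ for the translated game $(a-m,F)$ is the unique $t=t_u^{(m)}\in(0,u/(u+m-\xi))$ with $\int_I \frac{a(x)-m-u}{(a(x)-m)t-tu+u}\,dF=0$. Then $u_{\max}(m)$ denotes the unique number in $(0,E-m)$ such that $u\mapsto t_u^{(m)}$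 is strictly increasing on $(0,u_{\max}(m))$ and strictly decreasing on $(u_{\max}(m),E-m)$. The measure $\rho$ associated with the game is the unique measure on $(0,\infty)$ with $\int_0^\infty\frac{1}{t(t+1)}\rho(dt)<\infty$ and $\Psi(c)=\xi+\frac1{H_\xi}+\int_0^\infty\frac{c+\xi}{t(t+c+\xi)}\rho(dt)$ for all $c>-\xi$. A measurable function $f$, positive for all large $x$, is regularly varying of index $r\in\mathbb{R}$ (written $f\in R_r$) if $\lim_{x\to\infty}f(\lambda x)/f(x)=\lambda^r$ for every $\lambda>0$. The upper order of a positive function $f$ is $\omega_f=\limsup_{x\to\infty}\log f(x)/\log x$. *)

theory Defs
  imports "HOL-Probability.Probability"
begin

text \<open>
  A distribution function on an interval \<open>I\<close> is represented by its extension to the real line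
  (constantly 0 to the left of \<open>I\<close> and 1 to the right); the values of \<open>a\<close> outside \<open>I\<close> are irrelevant.
  As with Lebesgue measure, \<open>dF\<close> is the completed Lebesgue--Stieltjes measure, so Borel functions
  are in particular measurable.
\<close>

definition distribution_function_on :: "real set \<Rightarrow> (real \<Rightarrow> real) \<Rightarrow> bool" where
  "distribution_function_on I F \<longleftrightarrow>
     is_interval I \<and> mono F \<and> (\<forall>x. continuous (at_right x) F) \<and>
     (F \<longlongrightarrow> 0) at_bot \<and> (F \<longlongrightarrow> 1) at_top \<and> emeasure (interval_measure F) I = 1"

definition stieltjes_on :: "real set \<Rightarrow> (real \<Rightarrow> real) \<Rightarrow> real measure" where
  "stieltjes_on I F = restrict_space (completion (interval_measure F)) I"

definition game :: "real set \<Rightarrow> (real \<Rightarrow> real) \<Rightarrow> (real \<Rightarrow> real) \<Rightarrow> bool" where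
  "game I a F \<longleftrightarrow>
     distribution_function_on I F \<and>
     a \<in> borel_measurable (stieltjes_on I F) \<and>
     \<not> (\<exists>k. AE x in stieltjes_on I F. a x = k)"

text \<open>
  The expectation \<open>E\<close> as an extended real: the integral of the positive part minus the integral of
  the negative part.  The latter is finite whenever \<open>a\<close> is essentially bounded below.
\<close>

definition game_mean :: "real set \<Rightarrow> (real \<Rightarrow> real) \<Rightarrow> (real \<Rightarrow> real) \<Rightarrow> ereal" where
  "game_mean I a F =
     enn2ereal (\<integral>\<^sup>+x. ennreal (a x) \<partial>stieltjes_on I F) -
     enn2ereal (\<integral>\<^sup>+x. ennreal (- a x) \<partial>stieltjes_on I F)"

definition game_essinf :: "real set \<Rightarrow> (real \<Rightarrow> real) \<Rightarrow> (real \<Rightarrow> real) \<Rightarrow> ereal" where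
  "game_essinf I a F = - esssup (stieltjes_on I F) (\<lambda>x. - ereal (a x))"

abbreviation game_xi :: "real set \<Rightarrow> (real \<Rightarrow> real) \<Rightarrow> (real \<Rightarrow> real) \<Rightarrow> real" where
  "game_xi I a F \<equiv> real_of_ereal (game_essinf I a F)"

text \<open>
  The inverse is taken in \<^typ>\<open>ennreal\<close>, where \<open>inverse 0 = \<infinity>\<close> and \<open>inverse \<infinity> = 0\<close>: hence the value
  is \<open>\<infinity>\<close> if \<open>a = \<xi>\<close> has positive probability, and then \<open>1/H\<^sub>\<xi> = 0\<close>.
\<close>

definition game_H :: "real set \<Rightarrow> (real \<Rightarrow> real) \<Rightarrow> (real \<Rightarrow> real) \<Rightarrow> ennreal" where
  "game_H I a F = (\<integral>\<^sup>+x. inverse (ennreal (a x - game_xi I a F)) \<partial>stieltjes_on I F)"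

definition game_inv_H :: "real set \<Rightarrow> (real \<Rightarrow> real) \<Rightarrow> (real \<Rightarrow> real) \<Rightarrow> real" where
  "game_inv_H I a F = enn2real (inverse (game_H I a F))"

definition game_Psi :: "real set \<Rightarrow> (real \<Rightarrow> real) \<Rightarrow> (real \<Rightarrow> real) \<Rightarrow> real \<Rightarrow> real" where
  "game_Psi I a F c = 1 / (LINT x|stieltjes_on I F. 1 / (a x + c)) - c"

text \<open>
  Optimal proportion \<open>t\<^sub>u\<close> for the game \<open>(a - m, F)\<close>; the definite description is meaningful
  for \<open>\<xi> + 1/H\<^sub>\<xi> < m < E\<close> and \<open>0 < u < E - m\<close>.
\<close>

definition opt_prop :: "real set \<Rightarrow> (real \<Rightarrow> real) \<Rightarrow> (real \<Rightarrow> real) \<Rightarrow> real \<Rightarrow> real \<Rightarrow> real" where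
  "opt_prop I a F m u =
     (THE t. t \<in> {0 <..< u / (u + m - game_xi I a F)} \<and>
        (LINT x|stieltjes_on I F. (a x - m - u) / ((a x - m) * t - t * u + u)) = 0)"

definition u_max :: "real set \<Rightarrow> (real \<Rightarrow> real) \<Rightarrow> (real \<Rightarrow> real) \<Rightarrow> real \<Rightarrow> real" where
  "u_max I a F m =
     (THE v. 0 < v \<and> ereal v < game_mean I a F - ereal m \<and>
        strict_mono_on {0<..<v} (opt_prop I a F m) \<and>
        strict_antimono_on {u. v < u \<and> ereal u < game_mean I a F - ereal m} (opt_prop I a F m))"

definition associated_measure ::
    "real set \<Rightarrow> (real \<Rightarrow> real) \<Rightarrow> (real \<Rightarrow> real) \<Rightarrow> real measure \<Rightarrow> bool" where
  "associated_measure I a F \<rho> \<longleftrightarrow>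
     sets \<rho> = sets (restrict_space borel {0<..}) \<and>
     (\<integral>\<^sup>+t. ennreal (1 / (t * (t + 1))) \<partial>\<rho>) < \<infinity> \<and>
     (\<forall>c > - game_xi I a F.
        game_Psi I a F c = game_xi I a F + game_inv_H I a F +
          (LINT t|\<rho>. (c + game_xi I a F) / (t * (t + c + game_xi I a F))))"

definition regularly_varying :: "real \<Rightarrow> (real \<Rightarrow> real) \<Rightarrow> bool" where
  "regularly_varying r f \<longleftrightarrow>
     f \<in> borel_measurable borel \<and> (\<forall>\<^sub>F x in at_top. f x > 0) \<and>
     (\<forall>l>0. ((\<lambda>x. f (l * x) / f x) \<longlongrightarrow> l powr r) at_top)"

definition upper_order :: "(real \<Rightarrow> real) \<Rightarrow> ereal" where
  "upper_order f = Limsup at_top (\<lambda>x. ereal (ln (f x) / ln x))"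

end

theory Submission
  imports Defs
begin

text \<open>
  Write \<open>s = c + \<xi>\<close>. Since \<open>\<Psi>\<close> increases to \<open>E\<close>, the representation of \<open>\<Psi>\<close> becomes
  \<open>E - \<Psi> = g\<close>, where \<open>g s = \<integral> \<rho>(dt) / (s + t)\<close> is a Stieltjes transform. The optimality
  equation says \<open>\<Psi> c = m + u\<close>, so the maximum of the optimal proportion is a critical point in \<open>s\<close>,
  and along it both \<open>E - m\<close> and \<open>u_max m\<close> are explicit functions of \<open>s\<close>. Convergence of the
  derivative of \<open>u_max\<close> turns out to be convergence of \<open>s * g'' s / g' s\<close>, with limit \<open>r - 2\<close>, and
  the limit of \<open>u_max m / (E - m)\<close> then follows from l'Hopital's rule.

  Monotonicity of all derivatives of \<open>g\<close> propagates this to higher derivatives, which gives the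
  limits of all moments of \<open>x / (x + t)\<close> under the probability measures proportional to
  \<open>(x / (x + t))\<^sup>2 \<rho>(dt)\<close>. They are the moments of the Beta distribution with parameters \<open>2 - r\<close> and
  \<open>r\<close> (the point mass at 1 if \<open>r = 0\<close>), so Karamata's argument with the Weierstrass theorem shows
  that \<open>\<rho>(0, x]\<close> is asymptotically a constant multiple of \<open>- x\<^sup>2 * g' x\<close>.
\<close>

section \<open>Stieltjes transforms\<close>

text \<open>The limit of \<open>x * stj (Suc n) x / stj n x\<close> is \<open>(n - r) / n\<close>,
  which is 0 when n = r = 1: the limit law would be a point mass at 0, blind to the mass of \<rho>
  on (0, x], which lives on \<open>x / (x + t) \<ge> 1 / 2\<close>. From n = 2 on the limits are at
  least 1/2, so the passage from n to n + 1 never divides by a vanishing limit, and the limit law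
  has mean \<open>(2 - r) / 2 \<ge> 1 / 2\<close>, which makes the constant in Karamata's argument
  positive.

  The number r is read off from the limit L of the derivative of \<open>u_max\<close>: along the
  critical curve, 1 plus this derivative is asymptotic to
  \<open>stj 2 s / (2 * (s * stj 3 s))\<close>, and with \<kappa> = 1 + L this forces
  \<open>r = 2 - 1 / \<kappa>\<close>. The pointwise bound \<open>s \<le> s + t\<close> gives
  \<kappa> \<ge> 1/2, that is r \<ge> 0; nonnegativity of \<open>u_max\<close> gives \<kappa> \<le>
  1, that is r \<le> 1.

  In the last claim the exponents between 1 and 2 are the difficulty, since such a kernel is not
  dominated by its square; a sum of square kernels over dyadic scales takes over.\<close>

lemma inverse_power_tangent:
  fixes p q :: real
  assumes "p > 0" "q > 0"
  shows "real n * (q - p) * (1 / q ^ Suc n) \<le> 1 / p ^ n - 1 / q ^ n"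
proof -
  have "1 + real n * (q / p - 1) \<le> (1 + (q / p - 1)) ^ n"
    using assms by (intro Bernoulli_inequality) simp
  then have "(1 + real n * (q / p - 1)) / q ^ n \<le> (q / p) ^ n / q ^ n"
    using assms by (intro divide_right_mono) auto
  moreover have "(q / p) ^ n / q ^ n = 1 / p ^ n"
    using assms by (simp add: power_divide)
  moreover have "(1 + real n * (q / p - 1)) / q ^ n = 1 / q ^ n + real n * ((q - p) / p) / q ^ n"
    using assms by (simp add: field_simps)
  ultimately have "real n * ((q - p) / p) / q ^ n \<le> 1 / p ^ n - 1 / q ^ n"
    by linarith
  \<comment> \<open>Bernoulli's inequality produces the slope \<open>(q - p) / p\<close>; putting q
    in the denominator only lowers it, whichever sign \<open>q - p\<close> has.\<close>
  moreover have "(q - p) / q \<le> (q - p) / p"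
  proof (cases "p \<le> q")
    case True
    then show ?thesis using assms by (intro divide_left_mono) auto
  next
    case False
    then have "(p - q) / p \<le> (p - q) / q" using assms by (intro divide_left_mono) auto
    then show ?thesis by (simp add: diff_divide_distrib)
  qed
  then have "real n * ((q - p) / q) / q ^ n \<le> real n * ((q - p) / p) / q ^ n"
    using assms by (intro divide_right_mono mult_left_mono) auto
  ultimately show ?thesis by (simp add: field_simps)
qed

text \<open>In the coordinate \<open>y = ln x\<close>, the quotient \<open>x * f' x / f x\<close> is
  the slope of \<open>ln f\<close>. The mean value theorem turns the logarithm of
  \<open>f (l * x) / f x\<close> into \<open>ln l\<close> times that slope at an intermediate point,
  and the bound \<open>min 1 l * x\<close> sends this point to infinity together with x.\<close>

lemma tendsto_dilation_of_log_derivative: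
  fixes f f' :: "real \<Rightarrow> real"
  assumes pos: "\<And>x. x > 0 \<Longrightarrow> f x > 0"
    and der: "\<And>x. x > 0 \<Longrightarrow> (f has_real_derivative f' x) (at x)"
    and lim: "((\<lambda>x. x * f' x / f x) \<longlongrightarrow> k) at_top"
    and l: "l > 0"
  shows "((\<lambda>x. f (l * x) / f x) \<longlongrightarrow> l powr k) at_top"
proof -
  define w where "w = (\<lambda>y. ln (f (exp y)))"
  have w_der: "(w has_real_derivative exp y * f' (exp y) / f (exp y)) (at y)" for y
    unfolding w_def
  proof -
    have "((\<lambda>y. f (exp y)) has_real_derivative f' (exp y) * exp y) (at y)"
      using DERIV_chain2[OF der DERIV_exp] by simp
    from DERIV_chain2[OF DERIV_ln this] pos
    show "((\<lambda>y. ln (f (exp y))) has_real_derivative exp y * f' (exp y) / f (exp y)) (at y)"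
      by (simp add: field_simps)
  qed
  have "\<exists>z. z \<ge> min 1 l * x \<and> ln (f (l * x)) - ln (f x) = ln l * (z * f' z / f z)" if x: "x > 0" for x
  proof -
    have eq: "w (ln x) = ln (f x)" "w (ln x + ln l) = ln (f (l * x))"
      using x l by (simp_all add: w_def exp_add mult.commute)
    consider "l = 1" | "l > 1" | "l < 1" by linarith
    then show ?thesis
    proof cases
      case 1
      then show ?thesis using x by (intro exI[of _ x]) simp
    next
      case 2
      then have "ln x < ln x + ln l" by simp
      from MVT2[OF this w_der] obtain z where z: "ln x < z" "z < ln x + ln l"
        "w (ln x + ln l) - w (ln x) = (ln x + ln l - ln x) * (exp z * f' (exp z) / f (exp z))"
        by blast
      have "x \<le> exp z" using z(1) x by (simp flip: ln_le_cancel_iff)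
      then show ?thesis using z(3) 2 x unfolding eq by (intro exI[of _ "exp z"]) simp
    next
      case 3
      then have "ln x + ln l < ln x" using l by simp
      from MVT2[OF this w_der] obtain z where z: "ln x + ln l < z" "z < ln x"
        "w (ln x) - w (ln x + ln l) = (ln x - (ln x + ln l)) * (exp z * f' (exp z) / f (exp z))"
        by blast
      have "l * x \<le> exp z" using z(1) x l by (simp add: ln_mult flip: ln_le_cancel_iff)
      then show ?thesis using z(3) 3 x unfolding eq by (intro exI[of _ "exp z"]) simp
    qed
  qed
  then obtain z where z: "\<And>x. x > 0 \<Longrightarrow> z x \<ge> min 1 l * x"
      "\<And>x. x > 0 \<Longrightarrow> ln (f (l * x)) - ln (f x) = ln l * (z x * f' (z x) / f (z x))"
    by metis
  have "filterlim (\<lambda>x. min 1 l * x) at_top at_top"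
    using l by (intro filterlim_tendsto_pos_mult_at_top[OF tendsto_const] filterlim_ident) auto
  then have "filterlim z at_top at_top"
    by (rule filterlim_at_top_mono) (use z(1) in \<open>auto intro: eventually_mono[OF eventually_gt_at_top[of 0]]\<close>)
  then have "((\<lambda>x. z x * f' (z x) / f (z x)) \<longlongrightarrow> k) at_top"
    by (rule filterlim_compose[OF lim])
  then have "((\<lambda>x. exp (ln l * (z x * f' (z x) / f (z x)))) \<longlongrightarrow> exp (ln l * k)) at_top"
    by (intro tendsto_intros)
  moreover have "exp (ln l * k) = l powr k" using l by (simp add: powr_def mult.commute)
  moreover have "\<forall>\<^sub>F x in at_top. exp (ln l * (z x * f' (z x) / f (z x))) = f (l * x) / f x"
    using eventually_gt_at_top[of 0]
  proof eventually_elim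
    case (elim x)
    then have "exp (ln (f (l * x)) - ln (f x)) = f (l * x) / f x"
      using pos[of x] pos[of "l * x"] l by (simp add: exp_diff)
    then show ?case using z(2)[OF elim] by simp
  qed
  ultimately show ?thesis by (simp add: Lim_transform_eventually)
qed

text \<open>Integrability of \<open>1 / t\<close> is stronger than the condition in
  \<open>associated_measure\<close>; it is what a finite mean adds. That \<rho> is not zero reflects
  that the game is not constant.\<close>

locale half_line_measure =
  fixes \<rho> :: "real measure"
  assumes sets_rho: "sets \<rho> = sets (restrict_space borel {0<..})"
    and integrable_inverse: "integrable \<rho> (\<lambda>t. 1 / t)"
    and rho_nonzero: "emeasure \<rho> (space \<rho>) \<noteq> 0"
begin

lemma space_rho: "space \<rho> = {0<..}"
  using sets_eq_imp_space_eq[OF sets_rho] by (simp add: space_restrict_space)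

lemma borel_measurable_rho: "f \<in> borel_measurable borel \<Longrightarrow> f \<in> borel_measurable \<rho>"
  by (subst measurable_cong_sets[OF sets_rho refl]) (rule measurable_restrict_space1)

lemma not_AE_False: "\<not> (AE t in \<rho>. False)"
proof
  assume "AE t in \<rho>. False"
  then have "space \<rho> \<in> null_sets \<rho>"
    by (simp add: AE_iff_null)
  then show False using rho_nonzero by auto
qed

text \<open>Up to the factor \<open>(- 1) ^ n * fact n\<close>, \<open>stj (Suc n)\<close> is the
  n-th derivative of the Stieltjes transform \<open>stj 1\<close> on the positive axis.\<close>

definition stj :: "nat \<Rightarrow> real \<Rightarrow> real" where
  "stj n s = (LINT t|\<rho>. 1 / (s + t) ^ n)"

lemma integrable_stj:
  assumes "s > 0" "n \<ge> 1"
  shows "integrable \<rho> (\<lambda>t. 1 / (s + t) ^ n)"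
proof (rule Bochner_Integration.integrable_bound)
  show "integrable \<rho> (\<lambda>t. (1 / s ^ (n - 1)) * (1 / t))"
    by (intro integrable_mult_right integrable_inverse)
  show "(\<lambda>t. 1 / (s + t) ^ n) \<in> borel_measurable \<rho>"
    by (intro borel_measurable_rho) measurable
  show "AE t in \<rho>. norm (1 / (s + t) ^ n) \<le> norm (1 / s ^ (n - 1) * (1 / t))"
  proof (rule AE_I2)
    fix t assume "t \<in> space \<rho>"
    then have t: "t > 0" by (simp add: space_rho)
    have "s ^ (n - 1) * t \<le> (s + t) ^ (n - 1) * (s + t)"
      using t assms by (intro mult_mono power_mono) auto
    also have "\<dots> = (s + t) ^ n" using assms by (simp add: power_eq_if)
    finally have "1 / (s + t) ^ n \<le> 1 / (s ^ (n - 1) * t)"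
      using t assms by (intro divide_left_mono) auto
    then show "norm (1 / (s + t) ^ n) \<le> norm (1 / s ^ (n - 1) * (1 / t))"
      using t assms by simp
  qed
qed

lemma integral_rho_pos:
  assumes "integrable \<rho> f" "\<And>t. t > 0 \<Longrightarrow> f t > (0::real)"
  shows "integral\<^sup>L \<rho> f > 0"
proof -
  have "integral\<^sup>L \<rho> f \<ge> 0"
    by (intro integral_nonneg_AE AE_I2) (use assms(2) space_rho in \<open>auto simp: less_imp_le\<close>)
  moreover have "integral\<^sup>L \<rho> f \<noteq> 0"
  proof
    assume "integral\<^sup>L \<rho> f = 0"
    then have "AE t in \<rho>. f t = 0"
      by (subst (asm) integral_nonneg_eq_0_iff_AE[OF assms(1)])
         (use assms(2) space_rho in \<open>auto simp: less_imp_le intro!: AE_I2\<close>)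
    then have "AE t in \<rho>. False"
      using AE_space by eventually_elim (use assms(2) space_rho in force)
    then show False using not_AE_False by simp
  qed
  ultimately show ?thesis by simp
qed

lemma stj_pos: "s > 0 \<Longrightarrow> n \<ge> 1 \<Longrightarrow> stj n s > 0"
  unfolding stj_def by (rule integral_rho_pos[OF integrable_stj]) auto

text \<open>A tangent-line inequality of a convex function, integrated. Strict monotonicity,
  continuity and the derivative of \<open>stj n\<close> all follow from it, with no differentiation
  under the integral sign.\<close>

lemma stj_tangent:
  assumes "s > 0" "y > 0" "n \<ge> 1"
  shows "real n * (s - y) * stj (Suc n) s \<le> stj n y - stj n s"
proof -
  have "real n * (s - y) * stj (Suc n) s = (LINT t|\<rho>. real n * (s - y) * (1 / (s + t) ^ Suc n))"
    unfolding stj_def by (rule integral_mult_right_zero[symmetric])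
  also have "\<dots> \<le> (LINT t|\<rho>. 1 / (y + t) ^ n - 1 / (s + t) ^ n)"
  proof (intro integral_mono integrable_mult_right Bochner_Integration.integrable_diff integrable_stj)
    fix t assume "t \<in> space \<rho>"
    then show "real n * (s - y) * (1 / (s + t) ^ Suc n) \<le> 1 / (y + t) ^ n - 1 / (s + t) ^ n"
      using inverse_power_tangent[of "y + t" "s + t" n] assms by (simp add: space_rho)
  qed (use assms in auto)
  also have "\<dots> = stj n y - stj n s"
    unfolding stj_def using assms by (intro Bochner_Integration.integral_diff integrable_stj) auto
  finally show ?thesis .
qed

lemma stj_strict_antimono:
  assumes "0 < s" "s < y" "n \<ge> 1"
  shows "stj n y < stj n s"
proof -
  have "0 < real n * (y - s) * stj (Suc n) y"
    using assms stj_pos by simp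
  also have "\<dots> \<le> stj n s - stj n y"
    using assms by (intro stj_tangent) auto
  finally show ?thesis by simp
qed

lemma isCont_stj:
  assumes "s > 0" "n \<ge> 1"
  shows "isCont (stj n) s"
  unfolding isCont_def
proof (rule Lim_transform2[OF tendsto_const])
  \<comment> \<open>Keeping y above \<open>s / 2\<close> bounds both tangent slopes by
    \<open>n * stj (Suc n) (s / 2)\<close>, which gives a Lipschitz estimate near s.\<close>
  have ev: "\<forall>\<^sub>F y in at s. s / 2 < y"
    using assms by (intro order_tendstoD[OF tendsto_ident_at]) auto
  show "((\<lambda>y. stj n s - stj n y) \<longlongrightarrow> 0) (at s)"
  proof (rule Lim_null_comparison)
    show "\<forall>\<^sub>F y in at s. norm (stj n s - stj n y) \<le> real n * stj (Suc n) (s / 2) * \<bar>y - s\<bar>"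
      using ev
    proof eventually_elim
      case (elim y)
      then have y: "y > 0" using assms by linarith
      have mono: "x = s / 2 \<or> stj (Suc n) x < stj (Suc n) (s / 2)" if "s / 2 \<le> x" for x
        using that assms stj_strict_antimono[of "s/2" x "Suc n"] by force
      have "real n * (s - y) * stj (Suc n) s \<le> stj n y - stj n s"
           "real n * (y - s) * stj (Suc n) y \<le> stj n s - stj n y"
        using stj_tangent[of s y n] stj_tangent[of y s n] assms y by auto
      moreover have "\<bar>real n * (s - y) * stj (Suc n) s\<bar> \<le> real n * stj (Suc n) (s / 2) * \<bar>y - s\<bar>"
        using mono[of s] stj_pos[of s "Suc n"] assms
        by (auto simp: abs_mult abs_minus_commute mult.assoc mult.commute[of "stj _ _"]
            intro!: mult_left_mono)
      moreover have "\<bar>real n * (y - s) * stj (Suc n) y\<bar> \<le> real n * stj (Suc n) (s / 2) * \<bar>y - s\<bar>"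
        using mono[of y] stj_pos[of y "Suc n"] assms y elim
        by (auto simp: abs_mult abs_minus_commute mult.assoc mult.commute[of "stj _ _"]
            intro!: mult_left_mono)
      ultimately show ?case by auto
    qed
    have "((\<lambda>y. real n * stj (Suc n) (s / 2) * \<bar>y - s\<bar>) \<longlongrightarrow> real n * stj (Suc n) (s / 2) * \<bar>s - s\<bar>) (at s)"
      by (intro tendsto_intros)
    then show "((\<lambda>y. real n * stj (Suc n) (s / 2) * \<bar>y - s\<bar>) \<longlongrightarrow> 0) (at s)" by simp
  qed
qed

text \<open>The tangents at s and at y enclose the difference quotient between
  \<open>- n * stj (Suc n) s\<close> and \<open>- n * stj (Suc n) y\<close>; continuity of
  \<open>stj (Suc n)\<close> closes the gap.\<close>

lemma DERIV_stj:
  assumes "s > 0" "n \<ge> 1"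
  shows "(stj n has_real_derivative - real n * stj (Suc n) s) (at s)"
  unfolding has_field_derivative_iff
proof (rule Lim_transform2[OF tendsto_const])
  have ev: "\<forall>\<^sub>F y in at s. 0 < y \<and> y \<noteq> s"
    using assms by (intro eventually_conj order_tendstoD[OF tendsto_ident_at])
      (auto simp: eventually_at_filter)
  show "((\<lambda>y. - real n * stj (Suc n) s - (stj n y - stj n s) / (y - s)) \<longlongrightarrow> 0) (at s)"
  proof (rule Lim_null_comparison)
    show "\<forall>\<^sub>F y in at s. norm (- real n * stj (Suc n) s - (stj n y - stj n s) / (y - s))
            \<le> real n * \<bar>stj (Suc n) y - stj (Suc n) s\<bar>"
      using ev
    proof eventually_elim
      case (elim y)
      define q where "q = (stj n y - stj n s) / (y - s)"
      have q: "stj n y - stj n s = q * (y - s)" using elim by (simp add: q_def)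
      have 1: "real n * (s - y) * stj (Suc n) s \<le> q * (y - s)"
        using stj_tangent[of s y n] assms elim q by auto
      have 2: "real n * (y - s) * stj (Suc n) y \<le> - q * (y - s)"
        using stj_tangent[of y s n] assms elim q by auto
      have "\<bar>- real n * stj (Suc n) s - q\<bar> \<le> \<bar>real n * stj (Suc n) y - real n * stj (Suc n) s\<bar>"
      proof (cases "y > s")
        case True
        have "(- real n * stj (Suc n) s) * (y - s) \<le> q * (y - s)"
             "(real n * stj (Suc n) y) * (y - s) \<le> - q * (y - s)"
          using 1 2 by (simp_all add: algebra_simps)
        then have "- real n * stj (Suc n) s \<le> q" "real n * stj (Suc n) y \<le> - q"
          using True mult_right_le_imp_le[of _ "y - s"] by (metis diff_gt_0_iff_gt)+
        then show ?thesis by linarith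
      next
        case False
        have "(real n * stj (Suc n) s) * (s - y) \<le> - q * (s - y)"
             "(- real n * stj (Suc n) y) * (s - y) \<le> q * (s - y)"
          using 1 2 by (simp_all add: algebra_simps)
        then have "real n * stj (Suc n) s \<le> - q" "- real n * stj (Suc n) y \<le> q"
          using False elim mult_right_le_imp_le[of _ "s - y"]
          by (metis diff_gt_0_iff_gt linorder_less_linear)+
        then show ?thesis by linarith
      qed
      also have "\<dots> = real n * \<bar>stj (Suc n) y - stj (Suc n) s\<bar>"
        by (simp add: abs_mult flip: right_diff_distrib)
      finally show ?case by (simp add: q_def)
    qed
    have "(stj (Suc n) \<longlongrightarrow> stj (Suc n) s) (at s)"
      using isCont_stj[of s "Suc n"] assms by (simp add: isCont_def)
    then have "((\<lambda>y. real n * \<bar>stj (Suc n) y - stj (Suc n) s\<bar>) \<longlongrightarrow>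
        real n * \<bar>stj (Suc n) s - stj (Suc n) s\<bar>) (at s)"
      by (intro tendsto_intros)
    then show "((\<lambda>y. real n * \<bar>stj (Suc n) y - stj (Suc n) s\<bar>) \<longlongrightarrow> 0) (at s)" by simp
  qed
qed

text \<open>Pointwise this is \<open>s \<le> s + t\<close>. The case n = 1 makes
  \<open>s * stj 2 s\<close> vanish at infinity; the case n = 2 is the source of r \<ge> 0.\<close>

lemma mult_stj_Suc_le:
  assumes "s > 0" "n \<ge> 1"
  shows "s * stj (Suc n) s \<le> stj n s"
proof -
  have "s * stj (Suc n) s = (LINT t|\<rho>. s * (1 / (s + t) ^ Suc n))"
    unfolding stj_def by (rule integral_mult_right_zero[symmetric])
  also have "\<dots> \<le> stj n s"
    unfolding stj_def
  proof (intro integral_mono integrable_mult_right integrable_stj)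
    fix t assume "t \<in> space \<rho>"
    then have "s * (s + t) ^ n \<le> (s + t) ^ Suc n"
      using assms by (auto simp: space_rho intro!: mult_right_mono)
    then show "s * (1 / (s + t) ^ Suc n) \<le> 1 / (s + t) ^ n"
      using assms \<open>t \<in> space \<rho>\<close> by (simp add: space_rho divide_simps del: power_Suc)
  qed (use assms in auto)
  finally show ?thesis .
qed

lemma tendsto_stj_1: "(stj 1 \<longlongrightarrow> 0) at_top"
proof -
  have "((\<lambda>s. LINT t|\<rho>. 1 / (s + t) ^ 1) \<longlongrightarrow> (LINT t|\<rho>. 0)) at_top"
  proof (rule integral_dominated_convergence_at_top)
    show "(\<lambda>t. 1 / (s + t) ^ 1) \<in> borel_measurable \<rho>" for s
      by (intro borel_measurable_rho) measurable
    show "integrable \<rho> (\<lambda>t. 1 / t)" by (rule integrable_inverse)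
    show "\<forall>\<^sub>F s in at_top. AE t in \<rho>. norm (1 / (s + t) ^ 1) \<le> 1 / t"
      using eventually_gt_at_top[of 0] by eventually_elim (auto simp: space_rho field_simps)
    show "AE t in \<rho>. ((\<lambda>s. 1 / (s + t) ^ 1) \<longlongrightarrow> 0) at_top"
      proof (rule AE_I2)
      fix t :: real
      have "filterlim (\<lambda>s. t + s) at_top at_top"
        by (intro filterlim_tendsto_add_at_top[OF tendsto_const] filterlim_ident)
      then show "((\<lambda>s. 1 / (s + t) ^ 1) \<longlongrightarrow> 0) at_top"
        by (auto simp: add.commute intro!: tendsto_divide_0[OF tendsto_const] filterlim_at_top_imp_at_infinity)
    qed
  qed auto
  then show ?thesis by (simp add: stj_def[abs_def])
qed

lemma tendsto_mult_stj_2: "((\<lambda>s. s * stj 2 s) \<longlongrightarrow> 0) at_top"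
proof (rule tendsto_sandwich[OF _ _ tendsto_const tendsto_stj_1])
  show "\<forall>\<^sub>F s in at_top. 0 \<le> s * stj 2 s"
    using eventually_gt_at_top[of 0] by eventually_elim (use stj_pos[of _ 2] in \<open>auto simp: less_imp_le\<close>)
  show "\<forall>\<^sub>F s in at_top. s * stj 2 s \<le> stj 1 s"
    using eventually_gt_at_top[of 0] 
    by eventually_elim (use mult_stj_Suc_le[of _ 1] in \<open>auto simp: numeral_2_eq_2\<close>)
qed

lemma tendsto_stj_2: "(stj 2 \<longlongrightarrow> 0) at_top"
proof (rule tendsto_sandwich[OF _ _ tendsto_const tendsto_mult_stj_2])
  show "\<forall>\<^sub>F s in at_top. 0 \<le> stj 2 s"
    using eventually_gt_at_top[of 0] by eventually_elim (use stj_pos[of _ 2] in \<open>auto simp: less_imp_le\<close>)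
  show "\<forall>\<^sub>F s in at_top. stj 2 s \<le> s * stj 2 s"
    using eventually_gt_at_top[of 1] 
    by eventually_elim (use stj_pos[of _ 2] in \<open>auto simp: less_imp_le\<close>)
qed

end

section \<open>A Tauberian theorem\<close>

lemma Beta_real_moments:
  fixes r :: real
  assumes "0 < r" "r < 2"
  shows "Beta (2 - r + real k) r = Beta (2 - r) r * (\<Prod>j<k. (2 - r + real j) / (2 + real j))"
proof (induction k)
  case (Suc k)
  have "(2 - r + real k + r) * Beta (2 - r + real k + 1) r = (2 - r + real k) * Beta (2 - r + real k) r"
    using assms by (intro Beta_plus1_left) (auto dest: nonpos_Ints_nonpos)
  then have "Beta (2 - r + real k + 1) r = (2 - r + real k) / (2 + real k) * Beta (2 - r + real k) r"
    by (simp add: field_simps)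
  then show ?case using Suc by (simp add: add.assoc add.commute[of 1])
qed simp

text \<open>For r > 0 the measure has density proportional to
  \<open>v powr (1 - r) * (1 - v) powr (r - 1)\<close>; for r = 0 every factor of the product is 1
  and the point mass at 1 takes its place. The point 1/2 must be null because the test function of
  Karamata's argument jumps there.\<close>

lemma beta_moment_measure:
  fixes r :: real
  assumes "0 \<le> r" "r < 2"
  obtains \<mu> :: "real measure" where "prob_space \<mu>" "sets \<mu> = sets borel"
    "AE v in \<mu>. v \<in> {0..1}" "AE v in \<mu>. v \<noteq> 1 / 2"
    "\<And>k. (LINT v|\<mu>. v ^ k) = (\<Prod>j<k. (2 - r + real j) / (2 + real j))"
proof (cases "r = 0")
  case True
  have "(\<Prod>j<k. (2 - r + real j) / (2 + real j)) = 1" for k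
    by (rule prod.neutral) (use True in \<open>auto simp: field_simps add_eq_0_iff\<close>)
  then show ?thesis
    by (intro that[of "return borel 1"]) (auto simp: AE_return prob_space_return integral_return)
next
  case False
  then have r: "0 < r" "r < 2" using assms by auto
  define B where "B = Beta (2 - r) r"
  have B: "B > 0" using r by (simp add: B_def Beta_def)
  define d where "d = (\<lambda>v. ennreal (v powr (1 - r) * (1 - v) powr (r - 1) / B) * indicator {0..1} v)"
  define \<mu> where "\<mu> = density lborel d"
  have d_meas [measurable]: "d \<in> borel_measurable borel" unfolding d_def by measurable
  have nn: "(\<integral>\<^sup>+v. ennreal (v ^ k) \<partial>\<mu>) = ennreal (\<Prod>j<k. (2 - r + real j) / (2 + real j))" for k
  proof -
    have "((\<lambda>t. t powr (2 - r + real k - 1) * (1 - t) powr (r - 1)) has_integral Beta (2 - r + real k) r) {0..1}"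
      using r by (intro has_integral_Beta_real) auto
    from has_integral_divide[OF this, of B]
    have hi: "((\<lambda>t. t powr (2 - r + real k - 1) * (1 - t) powr (r - 1) / B) has_integral
        Beta (2 - r + real k) r / B) {0..1}" .
    have "(\<integral>\<^sup>+v. ennreal (v ^ k) \<partial>\<mu>) = (\<integral>\<^sup>+v. d v * ennreal (v ^ k) \<partial>lborel)"
      unfolding \<mu>_def by (subst nn_integral_density) auto
    also have "\<dots> = (\<integral>\<^sup>+v. ennreal (v powr (2 - r + real k - 1) * (1 - v) powr (r - 1) / B) * indicator {0..1} v \<partial>lborel)"
    proof (rule nn_integral_cong)
      fix v :: real
      show "d v * ennreal (v ^ k) = ennreal (v powr (2 - r + real k - 1) * (1 - v) powr (r - 1) / B) * indicator {0..1} v"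
      proof (cases "v \<in> {0..1}")
        case True
        \<comment> \<open>At v = 0 both sides are 0 even for k = 0, since
          \<open>0 powr z = 0\<close> for every z.\<close>
        have "v powr (2 - r + real k - 1) = v powr (1 - r) * v ^ k"
        proof (cases "v = 0")
          case False
          then have "v powr (1 - r + real k) = v powr (1 - r) * v ^ k"
            using True by (simp add: powr_add powr_realpow)
          moreover have "2 - r + real k - 1 = 1 - r + real k" by simp
          ultimately show ?thesis by (simp only:)
        qed simp
        then show ?thesis using True B by (simp add: d_def ennreal_mult' [symmetric] mult_ac)
      qed (simp add: d_def)
    qed
    also have "\<dots> = ennreal (Beta (2 - r + real k) r / B)"
      using B by (intro nn_integral_has_integral_lebesgue'[OF _ hi]) auto
    also have "Beta (2 - r + real k) r / B = (\<Prod>j<k. (2 - r + real j) / (2 + real j))"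
      using Beta_real_moments[OF r, of k] B by (simp add: B_def)
    finally show ?thesis .
  qed
  have ae: "AE v in \<mu>. v \<in> {0..1}"
    unfolding \<mu>_def by (subst AE_density) (auto simp: d_def intro!: AE_I2 split: split_indicator)
  show ?thesis
  proof (rule that[of \<mu>])
    show "prob_space \<mu>"
      using nn[of 0] by (intro prob_spaceI) (simp add: emeasure_eq_0_AE)
    show "sets \<mu> = sets borel" by (simp add: \<mu>_def)
    show "AE v in \<mu>. v \<in> {0..1}" by (rule ae)
    have "AE v in lborel. v \<noteq> (1 / 2 :: real)" by (rule AE_lborel_singleton)
    then show "AE v in \<mu>. v \<noteq> 1 / 2"
      unfolding \<mu>_def by (subst AE_density) auto
    fix k
    have "(LINT v|\<mu>. v ^ k) = enn2real (\<integral>\<^sup>+v. ennreal (v ^ k) \<partial>\<mu>)"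
    proof (rule integral_eq_nn_integral)
      show "(\<lambda>v. v ^ k) \<in> borel_measurable \<mu>" by (simp add: \<mu>_def)
      show "AE v in \<mu>. 0 \<le> v ^ k" using ae by eventually_elim auto
    qed
    also have "\<dots> = (\<Prod>j<k. (2 - r + real j) / (2 + real j))"
      using r by (auto simp: nn intro!: enn2real_ennreal prod_nonneg)
    finally show "(LINT v|\<mu>. v ^ k) = (\<Prod>j<k. (2 - r + real j) / (2 + real j))" .
  qed
qed

context half_line_measure
begin

lemma stj_dilation:
  assumes "n \<ge> 1" "((\<lambda>x. x * stj (Suc n) x / stj n x) \<longlongrightarrow> (real n - r) / real n) at_top" "l > 0"
  shows "((\<lambda>x. stj n (l * x) / stj n x) \<longlongrightarrow> l powr (r - real n)) at_top"
proof (rule tendsto_dilation_of_log_derivative)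
  show "stj n x > 0" if "x > 0" for x using that assms stj_pos by auto
  show "(stj n has_real_derivative - real n * stj (Suc n) x) (at x)" if "x > 0" for x
    using that assms by (intro DERIV_stj)
  have "((\<lambda>x. - real n * (x * stj (Suc n) x / stj n x)) \<longlongrightarrow> - real n * ((real n - r) / real n)) at_top"
    by (intro tendsto_intros assms)
  then show "((\<lambda>x. x * (- real n * stj (Suc n) x) / stj n x) \<longlongrightarrow> r - real n) at_top"
    using assms(1) by (simp add: mult_ac)
qed fact

text \<open>Monotone density argument: since \<open>stj n\<close> is convex with derivative \<open>- n * stj (Suc n)\<close>, its
  chords over \<open>[x, l * x]\<close> bound the derivative at \<open>x\<close> from either side; then let \<open>l \<rightarrow> 1\<close>.\<close>

lemma stj_ratio_of_dilation:
  assumes n: "n \<ge> 1"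
    and dil: "\<And>l. l > 0 \<Longrightarrow> ((\<lambda>x. stj n (l * x) / stj n x) \<longlongrightarrow> l powr (r - real n)) at_top"
  shows "((\<lambda>x. x * stj (Suc n) x / stj n x) \<longlongrightarrow> (real n - r) / real n) at_top"
proof -
  \<comment> \<open>\<open>Q l\<close> is the limit, as x grows, of the chord slope over
    \<open>[x, l * x]\<close> after scaling, and \<open>- 1 / n\<close> times the difference
    quotient of \<open>l powr (r - n)\<close> at 1.\<close>
  define Q where "Q = (\<lambda>l. (1 - l powr (r - real n)) / (real n * (l - 1)))"
  have "((\<lambda>l. l powr (r - real n)) has_real_derivative (r - real n) * 1 powr (r - real n - 1)) (at 1)"
    by (rule has_real_derivative_powr) simp
  then have "((\<lambda>l. (l powr (r - real n) - 1) / (l - 1)) \<longlongrightarrow> r - real n) (at 1)"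
    by (simp add: has_field_derivative_iff)
  then have "((\<lambda>l. - (1 / real n) * ((l powr (r - real n) - 1) / (l - 1))) \<longlongrightarrow> - (1 / real n) * (r - real n)) (at 1)"
    by (intro tendsto_intros)
  moreover have "(\<lambda>l. - (1 / real n) * ((l powr (r - real n) - 1) / (l - 1))) = Q"
  proof
    fix l
    have "- (1 / real n) * ((l powr (r - real n) - 1) / (l - 1)) = - ((1 * (l powr (r - real n) - 1)) / (real n * (l - 1)))"
      by (simp only: times_divide_times_eq mult_minus_left)
    also have "\<dots> = Q l"
      unfolding Q_def minus_divide_left by simp
    finally show "- (1 / real n) * ((l powr (r - real n) - 1) / (l - 1)) = Q l" .
  qed
  moreover have "- (1 / real n) * (r - real n) = (real n - r) / real n"
    using n by (simp add: field_simps)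
  ultimately have Q: "(Q \<longlongrightarrow> (real n - r) / real n) (at 1)" by simp
  have Qlim: "((\<lambda>x. (1 - stj n (l * x) / stj n x) / (real n * (l - 1))) \<longlongrightarrow> Q l) at_top" if "l > 0" for l
    unfolding Q_def divide_inverse[of _ "real n * (l - 1)"]
    by (intro tendsto_intros dil that)
  have key: "(stj n x - stj n (l * x)) / stj n x \<le> real n * (l - 1) * (x * stj (Suc n) x / stj n x)"
    if "l > 0" "x > 0" for l x
  proof -
    have "stj n x - stj n (l * x) \<le> real n * (l - 1) * (x * stj (Suc n) x)"
      using stj_tangent[of x "l * x" n] that n by (simp add: algebra_simps)
    from divide_right_mono[OF this, of "stj n x"] stj_pos[of x n] that n show ?thesis by simp
  qed
  show ?thesis
  proof (rule order_tendstoI)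
    fix b assume b: "b < (real n - r) / real n"
    have "(Q \<longlongrightarrow> (real n - r) / real n) (at_right 1)" using Q by (rule filterlim_at_split[THEN iffD1, THEN conjunct2])
    from order_tendstoD(1)[OF this b] have "\<forall>\<^sub>F l in at_right 1. b < Q l \<and> l > 1"
      using eventually_at_right_less[of "1::real"] by eventually_elim auto
    from eventually_happens[OF this] obtain l where l: "b < Q l" "l > 1" by auto
    have "\<forall>\<^sub>F x in at_top. b < (1 - stj n (l * x) / stj n x) / (real n * (l - 1))"
      using l by (intro order_tendstoD(1)[OF Qlim]) auto
    then show "\<forall>\<^sub>F x in at_top. b < x * stj (Suc n) x / stj n x"
      using eventually_gt_at_top[of 0]
    proof eventually_elim
      case (elim x)
      have "1 - stj n (l * x) / stj n x = (stj n x - stj n (l * x)) / stj n x"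
        using stj_pos[of x n] elim n by (simp add: diff_divide_distrib)
      then have "1 - stj n (l * x) / stj n x \<le> real n * (l - 1) * (x * stj (Suc n) x / stj n x)"
        using key[of l x] elim l by simp
      then have "(1 - stj n (l * x) / stj n x) / (real n * (l - 1)) \<le> x * stj (Suc n) x / stj n x"
        using l n by (subst pos_divide_le_eq) (auto simp: mult.commute)
      then show ?case using elim by linarith
    qed
  next
    \<comment> \<open>For l < 1 the factor \<open>n * (l - 1)\<close> is negative, so dividing
      \<open>key\<close> by it turns the chord into an upper bound.\<close>
    fix b assume b: "(real n - r) / real n < b"
    have "(Q \<longlongrightarrow> (real n - r) / real n) (at_left 1)" using Q by (rule filterlim_at_split[THEN iffD1, THEN conjunct1])
    from order_tendstoD(2)[OF this b] have "\<forall>\<^sub>F l in at_left 1. Q l < b \<and> l < 1 \<and> l > 0"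
      using eventually_at_left_real[OF zero_less_one] by eventually_elim auto
    from eventually_happens[OF this] obtain l where l: "Q l < b" "l < 1" "l > 0" by auto
    have "\<forall>\<^sub>F x in at_top. (1 - stj n (l * x) / stj n x) / (real n * (l - 1)) < b"
      using l by (intro order_tendstoD(2)[OF Qlim]) auto
    then show "\<forall>\<^sub>F x in at_top. x * stj (Suc n) x / stj n x < b"
      using eventually_gt_at_top[of 0]
    proof eventually_elim
      case (elim x)
      have "1 - stj n (l * x) / stj n x = (stj n x - stj n (l * x)) / stj n x"
        using stj_pos[of x n] elim n by (simp add: diff_divide_distrib)
      then have "1 - stj n (l * x) / stj n x \<le> real n * (l - 1) * (x * stj (Suc n) x / stj n x)"
        using key[of l x] elim l by simp
      then have "x * stj (Suc n) x / stj n x \<le> (1 - stj n (l * x) / stj n x) / (real n * (l - 1))"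
        using l n by (subst neg_le_divide_eq) (auto simp: mult.commute mult_pos_neg)
      then show ?case using elim by linarith
    qed
  qed
qed

text \<open>Since \<open>stj (Suc n) x = q x * stj n x / x\<close>, where q tends to a nonzero
  limit, \<open>stj (Suc n)\<close> inherits the dilation behaviour of \<open>stj n\<close> with the
  exponent lowered by one. The monotone density argument turns this back into a limit of
  ratios.\<close>

lemma stj_ratio_Suc:
  assumes n: "n \<ge> 1" "real n > r"
    and ratio: "((\<lambda>x. x * stj (Suc n) x / stj n x) \<longlongrightarrow> (real n - r) / real n) at_top"
  shows "((\<lambda>x. x * stj (Suc (Suc n)) x / stj (Suc n) x) \<longlongrightarrow> (real (Suc n) - r) / real (Suc n)) at_top"
proof (rule stj_ratio_of_dilation)
  fix l :: real assume l: "l > 0"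
  define q where "q = (\<lambda>x. x * stj (Suc n) x / stj n x)"
  have nz: "(real n - r) / real n \<noteq> 0" using n by simp
  have q: "(q \<longlongrightarrow> (real n - r) / real n) at_top" using ratio by (simp add: q_def)
  moreover have "filterlim (\<lambda>x. l * x) at_top at_top"
    using l by (intro filterlim_tendsto_pos_mult_at_top[OF tendsto_const] filterlim_ident) auto
  ultimately have ql: "((\<lambda>x. q (l * x)) \<longlongrightarrow> (real n - r) / real n) at_top"
    by (rule filterlim_compose)
  have "((\<lambda>x. (q (l * x) / q x) * (stj n (l * x) / stj n x) / l) \<longlongrightarrow>
     ((real n - r) / real n) / ((real n - r) / real n) * l powr (r - real n) / l) at_top"
    using l by (intro tendsto_intros ql q nz stj_dilation[OF n(1) ratio l]) auto
  moreover have "((real n - r) / real n) / ((real n - r) / real n) * l powr (r - real n) / l = l powr (r - real (Suc n))"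
    using l nz by (simp add: powr_diff powr_add)
  moreover have "\<forall>\<^sub>F x in at_top. (q (l * x) / q x) * (stj n (l * x) / stj n x) / l = stj (Suc n) (l * x) / stj (Suc n) x"
    using eventually_gt_at_top[of 0]
  proof eventually_elim
    case (elim x)
    then show ?case using l n stj_pos[of x n] stj_pos[of "l * x" n] by (simp add: q_def)
  qed
  ultimately show "((\<lambda>x. stj (Suc n) (l * x) / stj (Suc n) x) \<longlongrightarrow> l powr (r - real (Suc n))) at_top"
    by (simp add: Lim_transform_eventually)
qed simp

section \<open>Averages over \<rho> with weight \<open>(x / (x + t)) ^ 2\<close>\<close>

lemma kernel_integral:
  "(LINT t|\<rho>. (x / (x + t)) ^ n) = x ^ n * stj n x"
  unfolding stj_def by (subst integral_mult_right_zero[symmetric]) (simp add: power_divide)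

lemma integrable_kernel:
  assumes "x > 0" and f: "f \<in> borel_measurable borel" "\<And>v. v \<in> {0..1} \<Longrightarrow> \<bar>f v\<bar> \<le> c"
  shows "integrable \<rho> (\<lambda>t. f (x / (x + t)) * (x / (x + t)) ^ 2)"
proof (rule Bochner_Integration.integrable_bound)
  show "integrable \<rho> (\<lambda>t. c * (x ^ 2 * (1 / (x + t) ^ 2)))"
    using assms by (intro integrable_mult_right integrable_stj) auto
  show "(\<lambda>t. f (x / (x + t)) * (x / (x + t)) ^ 2) \<in> borel_measurable \<rho>"
    supply f(1)[measurable] by (intro borel_measurable_rho) measurable
  show "AE t in \<rho>. norm (f (x / (x + t)) * (x / (x + t)) ^ 2) \<le> norm (c * (x ^ 2 * (1 / (x + t) ^ 2)))"
  proof (rule AE_I2)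
    fix t assume "t \<in> space \<rho>"
    then have "x / (x + t) \<in> {0..1}" using assms by (auto simp: space_rho field_simps)
    from f(2)[OF this] show "norm (f (x / (x + t)) * (x / (x + t)) ^ 2) \<le> norm (c * (x ^ 2 * (1 / (x + t) ^ 2)))"
      by (auto simp: abs_mult power_divide intro!: mult_right_mono divide_right_mono)
  qed
qed

lemma stj_ratio:
  assumes r: "r < 2" and n: "n \<ge> 2"
    and ratio: "((\<lambda>x. x * stj 3 x / stj 2 x) \<longlongrightarrow> (2 - r) / 2) at_top"
  shows "((\<lambda>x. x * stj (Suc n) x / stj n x) \<longlongrightarrow> (real n - r) / real n) at_top"
  using n
proof (induction n rule: dec_induct)
  case base
  then show ?case using ratio by simp
next
  case (step n)
  then show ?case using r by (intro stj_ratio_Suc) auto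
qed

text \<open>The quotient is the k-th moment of \<open>x / (x + t)\<close> under the normalized
  weight; it telescopes into the ratios \<open>x * stj (Suc n) x / stj n x\<close> for n from 2 to k
  + 1.\<close>

lemma stj_moments:
  assumes r: "r < 2"
    and ratio: "((\<lambda>x. x * stj 3 x / stj 2 x) \<longlongrightarrow> (2 - r) / 2) at_top"
  shows "((\<lambda>x. x ^ (k + 2) * stj (k + 2) x / (x ^ 2 * stj 2 x)) \<longlongrightarrow>
    (\<Prod>j<k. (2 - r + real j) / (2 + real j))) at_top"
proof (induction k)
  case 0
  have "\<forall>\<^sub>F x in at_top. 1 = x ^ (0 + 2) * stj (0 + 2) x / (x ^ 2 * stj 2 x)"
    unfolding add_0 using eventually_gt_at_top[of 0]
    by eventually_elim (use stj_pos[of _ 2] in \<open>auto simp: less_imp_neq[symmetric]\<close>)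
  from Lim_transform_eventually[OF tendsto_const this] show ?case
    by (simp only: lessThan_0 prod.empty)
next
  case (Suc k)
  have "((\<lambda>x. x * stj (Suc (k + 2)) x / stj (k + 2) x) \<longlongrightarrow> (real (k + 2) - r) / real (k + 2)) at_top"
    by (intro stj_ratio r ratio) simp
  from tendsto_mult[OF Suc this]
  have "((\<lambda>x. x ^ (k + 2) * stj (k + 2) x / (x ^ 2 * stj 2 x) * (x * stj (Suc (k + 2)) x / stj (k + 2) x)) \<longlongrightarrow>
      (\<Prod>j<Suc k. (2 - r + real j) / (2 + real j))) at_top"
    by (simp add: algebra_simps)
  moreover have "\<forall>\<^sub>F x in at_top. x ^ (k + 2) * stj (k + 2) x / (x ^ 2 * stj 2 x) * (x * stj (Suc (k + 2)) x / stj (k + 2) x)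
      = x ^ (Suc k + 2) * stj (Suc k + 2) x / (x ^ 2 * stj 2 x)"
    using eventually_gt_at_top[of 0]
  proof eventually_elim
    case (elim x)
    have "stj (k + 2) x > 0" using elim by (intro stj_pos) auto
    then show ?case by simp
  qed
  ultimately show ?case by (rule Lim_transform_eventually)
qed

text \<open>\<open>x ^ 2 * stj 2 x\<close> is the total weight, so the quotient is an average. The
  bound is uniform in x, as the approximation by polynomials requires.\<close>

lemma weighted_average_bounded:
  assumes "x > 0" and f: "f \<in> borel_measurable borel" "\<And>v. v \<in> {0..1} \<Longrightarrow> \<bar>f v\<bar> \<le> c"
  shows "\<bar>(LINT t|\<rho>. f (x / (x + t)) * (x / (x + t)) ^ 2) / (x ^ 2 * stj 2 x)\<bar> \<le> c"
proof -
  have pos: "x ^ 2 * stj 2 x > 0" using assms stj_pos[of x 2] by simp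
  have "\<bar>LINT t|\<rho>. f (x / (x + t)) * (x / (x + t)) ^ 2\<bar> \<le> (LINT t|\<rho>. \<bar>f (x / (x + t)) * (x / (x + t)) ^ 2\<bar>)"
    by (rule integral_abs_bound)
  also have "\<dots> \<le> (LINT t|\<rho>. c * (x / (x + t)) ^ 2)"
  proof (intro integral_mono integrable_abs integrable_kernel[OF assms])
    show "integrable \<rho> (\<lambda>t. c * (x / (x + t)) ^ 2)"
      using integrable_kernel[of x "\<lambda>_. c" "\<bar>c\<bar>"] assms by simp
    fix t assume "t \<in> space \<rho>"
    then have "x / (x + t) \<in> {0..1}" using assms by (auto simp: space_rho field_simps)
    from f(2)[OF this] show "\<bar>f (x / (x + t)) * (x / (x + t)) ^ 2\<bar> \<le> c * (x / (x + t)) ^ 2"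
      by (auto simp: abs_mult intro!: mult_right_mono)
  qed auto
  also have "\<dots> = c * (x ^ 2 * stj 2 x)"
    by (simp add: kernel_integral del: power_divide)
  finally show ?thesis using pos by (simp add: abs_divide pos_divide_le_eq)
qed

text \<open>The method of moments: polynomials are covered by \<open>stj_moments\<close>, and a
  polynomial within \<open>e / 3\<close> of f on the unit interval changes both the average, for
  every x > 0, and its limit by at most \<open>e / 3\<close>.\<close>

lemma tendsto_weighted_average:
  assumes r: "r < 2"
    and ratio: "((\<lambda>x. x * stj 3 x / stj 2 x) \<longlongrightarrow> (2 - r) / 2) at_top"
    and mu: "prob_space \<mu>" "sets \<mu> = sets borel" "AE v in \<mu>. v \<in> {0..1}"
      "\<And>k. (LINT v|\<mu>. v ^ k) = (\<Prod>j<k. (2 - r + real j) / (2 + real j))"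
    and f: "continuous_on UNIV f" "\<And>v. v \<in> {0..1} \<Longrightarrow> \<bar>f v\<bar> \<le> c"
  shows "((\<lambda>x. (LINT t|\<rho>. f (x / (x + t)) * (x / (x + t)) ^ 2) / (x ^ 2 * stj 2 x)) \<longlongrightarrow> integral\<^sup>L \<mu> f) at_top"
proof -
  interpret mu: prob_space \<mu> by fact
  define T where "T = (\<lambda>f x. (LINT t|\<rho>. f (x / (x + t)) * (x / (x + t)) ^ 2) / (x ^ 2 * stj 2 x))"
  have fm: "g \<in> borel_measurable borel" if "continuous_on UNIV g" for g :: "real \<Rightarrow> real"
    using that by (rule borel_measurable_continuous_onI)
  have bdd: "\<exists>c. \<forall>v\<in>{0..1}. \<bar>g v\<bar> \<le> c" if "continuous_on UNIV g" for g :: "real \<Rightarrow> real"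
  proof -
    have "compact (g ` {0..1})"
      using that by (intro compact_continuous_image) (auto intro: continuous_on_subset)
    then show ?thesis using compact_imp_bounded[of "g ` {0..1}"] by (auto simp: bounded_iff)
  qed
  have mint: "integrable \<mu> g" if cont: "continuous_on UNIV g" for g :: "real \<Rightarrow> real"
  proof -
    obtain c where "\<forall>v\<in>{0..1}. \<bar>g v\<bar> \<le> c" using bdd[OF cont] by blast
    moreover have "g \<in> borel_measurable \<mu>"
      using fm[OF cont] by (subst measurable_cong_sets[OF mu(2) refl])
    ultimately show ?thesis
      by (intro mu.integrable_const_bound[of _ c]) (use mu(3) in auto)
  qed
  have poly: "(T p \<longlongrightarrow> integral\<^sup>L \<mu> p) at_top" if p: "p = (\<lambda>v. \<Sum>i\<le>N. a i * v ^ i)" for p a and N :: nat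
  proof -
    have "((\<lambda>x. \<Sum>i\<le>N. a i * (x ^ (i + 2) * stj (i + 2) x / (x ^ 2 * stj 2 x))) \<longlongrightarrow>
      (\<Sum>i\<le>N. a i * (LINT v|\<mu>. v ^ i))) at_top"
      unfolding mu(4) by (intro tendsto_intros stj_moments r ratio)
    also have "(\<Sum>i\<le>N. a i * (LINT v|\<mu>. v ^ i)) = integral\<^sup>L \<mu> p"
      unfolding p by (subst Bochner_Integration.integral_sum) (auto intro!: mint continuous_intros)
    finally have lim: "((\<lambda>x. \<Sum>i\<le>N. a i * (x ^ (i + 2) * stj (i + 2) x / (x ^ 2 * stj 2 x))) \<longlongrightarrow> integral\<^sup>L \<mu> p) at_top" .
    have "\<forall>\<^sub>F x in at_top. (\<Sum>i\<le>N. a i * (x ^ (i + 2) * stj (i + 2) x / (x ^ 2 * stj 2 x))) = T p x"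
      using eventually_gt_at_top[of 0]
    proof eventually_elim
      case (elim x)
      have int: "integrable \<rho> (\<lambda>t. (x / (x + t)) ^ (i + 2))" for i
        unfolding power_divide divide_inverse[of "x ^ _"]
        using integrable_mult_right[OF integrable_stj[of x "i + 2"], of "x ^ (i + 2)"] elim
        by (simp add: divide_inverse)
      have "(LINT t|\<rho>. p (x / (x + t)) * (x / (x + t)) ^ 2) = (LINT t|\<rho>. (\<Sum>i\<le>N. a i * (x / (x + t)) ^ (i + 2)))"
        unfolding p power_add by (simp add: sum_distrib_right mult.assoc)
      also have "\<dots> = (\<Sum>i\<le>N. (LINT t|\<rho>. a i * (x / (x + t)) ^ (i + 2)))"
        by (intro Bochner_Integration.integral_sum integrable_mult_right int)
      also have "\<dots> = (\<Sum>i\<le>N. a i * (x ^ (i + 2) * stj (i + 2) x))"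
        by (simp only: integral_mult_right_zero kernel_integral)
      finally show ?case unfolding T_def by (simp add: sum_divide_distrib)
    qed
    with lim show ?thesis by (rule Lim_transform_eventually)
  qed
  have "(T f \<longlongrightarrow> integral\<^sup>L \<mu> f) at_top"
  proof (rule tendstoI)
    fix e :: real assume e: "e > 0"
    obtain g where g: "real_polynomial_function g" "\<And>v. v \<in> {0..1} \<Longrightarrow> \<bar>f v - g v\<bar> < e / 3"
      using Stone_Weierstrass_real_polynomial_function[of "{0..1::real}" f "e / 3"] e f(1)
      by (auto intro: continuous_on_subset)
    from g(1) obtain a N where ga: "g = (\<lambda>v. \<Sum>i\<le>N. a i * v ^ i)"
      by (auto simp: real_polynomial_function_iff_sum)
    have gc: "continuous_on UNIV g" unfolding ga by (intro continuous_intros)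
    have "\<forall>\<^sub>F x in at_top. dist (T g x) (integral\<^sup>L \<mu> g) < e / 3"
      using e by (intro tendstoD[OF poly[OF ga]]) auto
    then show "\<forall>\<^sub>F x in at_top. dist (T f x) (integral\<^sup>L \<mu> f) < e"
      using eventually_gt_at_top[of 0]
    proof eventually_elim
      case (elim x)
      obtain cg where cg: "\<And>v. v \<in> {0..1} \<Longrightarrow> \<bar>g v\<bar> \<le> cg" using bdd[OF gc] by blast
      have "T f x - T g x = (LINT t|\<rho>. (\<lambda>v. f v - g v) (x / (x + t)) * (x / (x + t)) ^ 2) / (x ^ 2 * stj 2 x)"
        unfolding T_def diff_divide_distrib[symmetric] left_diff_distrib
        by (subst Bochner_Integration.integral_diff[OF integrable_kernel[OF elim(2) fm[OF f(1)] f(2)]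
              integrable_kernel[OF elim(2) fm[OF gc] cg]]) simp_all
      also have "\<bar>\<dots>\<bar> \<le> e / 3"
        using elim g(2) fm[OF f(1)] fm[OF gc]
        by (intro weighted_average_bounded) (auto simp: less_imp_le)
      finally have 1: "\<bar>T f x - T g x\<bar> \<le> e / 3" .
      have "integral\<^sup>L \<mu> f - integral\<^sup>L \<mu> g = (LINT v|\<mu>. f v - g v)"
        by (intro Bochner_Integration.integral_diff[symmetric] mint f gc)
      also have "\<bar>\<dots>\<bar> \<le> (LINT v|\<mu>. \<bar>f v - g v\<bar>)" by (rule integral_abs_bound)
      also have "\<dots> \<le> (LINT v|\<mu>. e / 3)"
      proof (rule integral_mono_AE)
        show "AE v in \<mu>. \<bar>f v - g v\<bar> \<le> e / 3"
          using mu(3) by eventually_elim (use g(2) in \<open>auto simp: less_imp_le\<close>)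
      qed (auto intro!: mint continuous_intros f gc)
      also have "\<dots> = e / 3" by (simp add: mu.prob_space)
      finally have 2: "\<bar>integral\<^sup>L \<mu> f - integral\<^sup>L \<mu> g\<bar> \<le> e / 3" .
      show ?case using 1 2 elim(1) unfolding dist_real_def by linarith
    qed
  qed
  then show ?thesis by (simp add: T_def)
qed

section \<open>The distribution function of \<rho>\<close>

lemma emeasure_rho_Ioc_finite: "emeasure \<rho> {0<..x} < \<infinity>"
proof (cases "x > 0")
  case True
  have "emeasure \<rho> {0<..x} = (\<integral>\<^sup>+t. indicator {0<..x} t \<partial>\<rho>)"
    by (rule nn_integral_indicator[symmetric]) (auto simp: sets_rho sets_restrict_space intro!: image_eqI[of _ _ "{0<..x}"])
  also have "\<dots> \<le> (\<integral>\<^sup>+t. ennreal (x * (1 / t)) \<partial>\<rho>)"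
    by (intro nn_integral_mono) (auto simp: space_rho field_simps split: split_indicator)
  also have "\<dots> < \<infinity>"
    using integrable_mult_right[OF integrable_inverse, of x]
    by (simp add: real_integrable_def less_top)
  finally show ?thesis .
qed simp

text \<open>The condition \<open>t \<le> x\<close> says that \<open>x / (x + t)\<close> is at least
  1/2, and division by \<open>v ^ 2\<close> removes the weight.\<close>

lemma measure_Ioc_eq_weighted_integral:
  assumes "x > 0"
  shows "measure \<rho> {0<..x} =
    (LINT t|\<rho>. (\<lambda>v. indicator {1 / 2..} v / v ^ 2) (x / (x + t)) * (x / (x + t)) ^ 2)"
proof -
  have "measure \<rho> {0<..x} = (LINT t|\<rho>. indicator {0<..x} t)"
    by (subst Bochner_Integration.integral_indicator) (auto simp: space_rho intro!: arg_cong[of _ _ "measure \<rho>"])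
  also have "\<dots> = (LINT t|\<rho>. (\<lambda>v. indicator {1 / 2..} v / v ^ 2) (x / (x + t)) * (x / (x + t)) ^ 2)"
    using assms by (intro Bochner_Integration.integral_cong) 
      (auto simp: space_rho field_simps split: split_indicator)
  finally show ?thesis .
qed

text \<open>Karamata's argument: the test function h jumps at 1/2, so it is enclosed between
  continuous functions whose integrals against the limit law approach that of h. The constant is
  this last integral.\<close>

lemma measure_Ioc_asymptotic:
  assumes r: "0 \<le> r" "r \<le> 1"
    and ratio: "((\<lambda>x. x * stj 3 x / stj 2 x) \<longlongrightarrow> (2 - r) / 2) at_top"
  obtains C where "C > 0" "((\<lambda>x. measure \<rho> {0<..x} / (x ^ 2 * stj 2 x)) \<longlongrightarrow> C) at_top"
proof -
  obtain \<mu> :: "real measure" where mu: "prob_space \<mu>" "sets \<mu> = sets borel"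
    "AE v in \<mu>. v \<in> {0..1}" "AE v in \<mu>. v \<noteq> 1 / 2"
    "\<And>k. (LINT v|\<mu>. v ^ k) = (\<Prod>j<k. (2 - r + real j) / (2 + real j))"
    using beta_moment_measure[of r] r by auto
  interpret mu: prob_space \<mu> by fact
  have bm: "g \<in> borel_measurable \<mu>" if "g \<in> borel_measurable borel" for g :: "real \<Rightarrow> real"
    using that by (subst measurable_cong_sets[OF mu(2) refl])
  define T where "T = (\<lambda>f x. (LINT t|\<rho>. f (x / (x + t)) * (x / (x + t)) ^ 2) / (x ^ 2 * stj 2 x))"
  define h where "h = (\<lambda>v::real. indicator {1 / 2..} v / v ^ 2 :: real)"
  \<comment> \<open>With b = 0 the ramp rises to the right of 1/2 and stays below h; with b = 1 it
    rises to the left and stays above. The \<open>max\<close> in the denominator gives continuity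
    and the common bound 4.\<close>
  define ramp where "ramp = (\<lambda>b n v. min 1 (max 0 (real n * (v - 1 / 2) + b)) / (max v (1 / 2)) ^ 2)"
  have hm: "h \<in> borel_measurable borel" unfolding h_def by measurable
  have hb: "\<bar>h v\<bar> \<le> 4" for v
  proof (cases "v \<ge> 1 / 2")
    case True
    then have "(1 / 2) ^ 2 \<le> v ^ 2" by (intro power_mono) auto
    then show ?thesis using True by (simp add: h_def field_simps)
  qed (simp add: h_def)
  have hint: "integrable \<mu> h"
    by (rule mu.integrable_const_bound[of _ 4]) (use hb bm[OF hm] in auto)
  have rc: "continuous_on UNIV (ramp b n)" for b n
    unfolding ramp_def by (intro continuous_intros) auto
  have rb: "\<bar>ramp b n v\<bar> \<le> 4" for b n v
  proof -
    have "(1 / 2) ^ 2 \<le> (max v (1 / 2)) ^ 2" by (intro power_mono) auto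
    then have "1 / (max v (1 / 2)) ^ 2 \<le> 1 / (1 / 2) ^ 2" by (intro divide_left_mono) auto
    moreover have "ramp b n v \<le> 1 / (max v (1 / 2)) ^ 2"
      unfolding ramp_def by (intro divide_right_mono) auto
    moreover have "0 \<le> ramp b n v" unfolding ramp_def by auto
    ultimately show ?thesis by (simp add: power2_eq_square)
  qed
  have rint: "integrable \<mu> (ramp b n)" for b n
    by (rule mu.integrable_const_bound[of _ 4]) (use rb bm[OF borel_measurable_continuous_onI[OF rc]] in auto)
  have ramp_lim: "(\<lambda>n. integral\<^sup>L \<mu> (ramp b n)) \<longlonglongrightarrow> integral\<^sup>L \<mu> h" for b
  proof (rule integral_dominated_convergence)
    show "AE v in \<mu>. (\<lambda>n. ramp b n v) \<longlonglongrightarrow> h v"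
      using mu(4)
    proof eventually_elim
      case (elim v)
      have top: "filterlim (\<lambda>n. real n * d + b) at_top sequentially" if "d > 0" for d
        unfolding add.commute[of _ b] using that
        by (intro filterlim_tendsto_add_at_top[OF tendsto_const]
            filterlim_at_top_mult_tendsto_pos[OF tendsto_const] filterlim_real_sequentially) auto
      have "\<forall>\<^sub>F n in sequentially. ramp b n v = h v"
      proof (cases "v > 1 / 2")
        case True
        then have "\<forall>\<^sub>F n in sequentially. 1 \<le> real n * (v - 1 / 2) + b"
          using top[of "v - 1 / 2"] by (simp add: filterlim_at_top)
        then show ?thesis by eventually_elim (use True in \<open>auto simp: ramp_def h_def\<close>)
      next
        case False
        then have "v < 1 / 2" using elim by simp
        \<comment> \<open>After cancelling one b, this says that
          \<open>real n * (v - 1 / 2) + b\<close> is at most 0, so the ramp vanishes at v.\<close>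
        then have "\<forall>\<^sub>F n in sequentially. 2 * b \<le> real n * (1 / 2 - v) + b"
          using top[of "1 / 2 - v"] unfolding filterlim_at_top by (simp only: diff_gt_0_iff_gt)
        then show ?thesis
          by eventually_elim (use False elim in \<open>auto simp: ramp_def h_def algebra_simps\<close>)
      qed
      then show ?case by (rule tendsto_eventually)
    qed
    show "h \<in> borel_measurable \<mu>" by (intro bm hm)
    show "ramp b n \<in> borel_measurable \<mu>" for n by (intro bm borel_measurable_continuous_onI rc)
    show "integrable \<mu> (\<lambda>_. 4::real)" by simp
    show "AE v in \<mu>. norm (ramp b n v) \<le> 4" for n by (simp add: rb)
  qed
  have Tramp: "(T (ramp b n) \<longlongrightarrow> integral\<^sup>L \<mu> (ramp b n)) at_top" for b n
    unfolding T_def using r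
    by (intro tendsto_weighted_average[where f = "ramp b n" and c = 4, OF _ ratio mu(1,2,3,5) rc rb]) auto
  have T_mono: "T f x \<le> T g x" if "x > 0" "f \<in> borel_measurable borel" "g \<in> borel_measurable borel"
      "\<And>v. \<bar>f v\<bar> \<le> 4" "\<And>v. \<bar>g v\<bar> \<le> 4" "\<And>v. f v \<le> g v" for f g x
    unfolding T_def using that stj_pos[of x 2]
    by (intro divide_right_mono integral_mono integrable_kernel[of _ _ 4] mult_right_mono) auto
  have lower: "ramp 0 n v \<le> h v" for n v
  proof (cases "v \<ge> 1 / 2")
    case True
    then have "max v (1 / 2) = v" by simp
    then show ?thesis using True by (simp add: ramp_def h_def divide_right_mono)
  next
    case False
    then have "real n * (v - 1 / 2) \<le> 0" by (intro mult_nonneg_nonpos) auto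
    then show ?thesis using False by (simp add: ramp_def h_def)
  qed
  have upper: "h v \<le> ramp 1 n v" for n v
    by (cases "v \<ge> 1 / 2") (auto simp: ramp_def h_def)
  have Th: "(T h \<longlongrightarrow> integral\<^sup>L \<mu> h) at_top"
  proof (rule order_tendstoI)
    fix y assume "y < integral\<^sup>L \<mu> h"
    from order_tendstoD(1)[OF ramp_lim[of 0] this] obtain n where "y < integral\<^sup>L \<mu> (ramp 0 n)"
      by (auto simp: eventually_sequentially)
    from order_tendstoD(1)[OF Tramp this] show "\<forall>\<^sub>F x in at_top. y < T h x"
      using eventually_gt_at_top[of 0]
    proof eventually_elim
      case (elim x)
      have "T (ramp 0 n) x \<le> T h x"
        by (intro T_mono elim rb hb lower hm borel_measurable_continuous_onI rc)
      then show ?case using elim by linarith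
    qed
  next
    fix y assume "integral\<^sup>L \<mu> h < y"
    from order_tendstoD(2)[OF ramp_lim[of 1] this] obtain n where "integral\<^sup>L \<mu> (ramp 1 n) < y"
      by (auto simp: eventually_sequentially)
    from order_tendstoD(2)[OF Tramp this] show "\<forall>\<^sub>F x in at_top. T h x < y"
      using eventually_gt_at_top[of 0]
    proof eventually_elim
      case (elim x)
      have "T h x \<le> T (ramp 1 n) x"
        by (intro T_mono elim rb hb upper hm borel_measurable_continuous_onI rc)
      then show ?case using elim by linarith
    qed
  qed
  \<comment> \<open>If h vanished almost everywhere, v would be almost surely below 1/2, against the
    mean \<open>(2 - r) / 2 \<ge> 1 / 2\<close>. This is where r \<le> 1 enters.\<close>
  have "integral\<^sup>L \<mu> h \<noteq> 0"
  proof
    assume "integral\<^sup>L \<mu> h = 0"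
    moreover have "h v \<ge> 0" for v by (simp add: h_def)
    ultimately have "AE v in \<mu>. h v = 0"
      by (subst (asm) integral_nonneg_eq_0_iff_AE[OF hint]) auto
    then have lt: "AE v in \<mu>. v < 1 / 2"
      by eventually_elim (auto simp: h_def split: split_indicator_asm)
    have "(LINT v|\<mu>. v) < (LINT v|\<mu>. 1 / 2)"
    proof (rule mu.integral_less_AE_space)
      show "integrable \<mu> (\<lambda>v. v)"
        by (rule mu.integrable_const_bound[of _ 1]) (use mu(3) bm[of "\<lambda>v. v"] in auto)
    qed (use lt mu.emeasure_space_1 in auto)
    moreover have "(LINT v|\<mu>. v) = (2 - r) / 2" using mu(5)[of 1] by simp
    ultimately show False using r by (simp add: mu.prob_space)
  qed
  moreover have "integral\<^sup>L \<mu> h \<ge> 0" by (intro integral_nonneg_AE AE_I2) (simp add: h_def)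
  moreover have "((\<lambda>x. measure \<rho> {0<..x} / (x ^ 2 * stj 2 x)) \<longlongrightarrow> integral\<^sup>L \<mu> h) at_top"
  proof (rule Lim_transform_eventually[OF Th])
    show "\<forall>\<^sub>F x in at_top. T h x = measure \<rho> {0<..x} / (x ^ 2 * stj 2 x)"
      using eventually_gt_at_top[of 0]
      by eventually_elim (simp add: T_def h_def measure_Ioc_eq_weighted_integral del: power_divide)
  qed
  ultimately show ?thesis using that[of "integral\<^sup>L \<mu> h"] by simp
qed

text \<open>The measure of (0, x] is asymptotic to a positive multiple of
  \<open>x ^ 2 * stj 2 x\<close>, and \<open>stj 2\<close> scales with exponent r - 2.\<close>

lemma regularly_varying_measure_Ioc:
  assumes r: "0 \<le> r" "r \<le> 1"
    and ratio: "((\<lambda>x. x * stj 3 x / stj 2 x) \<longlongrightarrow> (2 - r) / 2) at_top"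
  shows "regularly_varying r (\<lambda>x. measure \<rho> {0<..x})"
proof -
  define R where "R = (\<lambda>x. measure \<rho> {0<..x})"
  define p where "p = (\<lambda>x. x ^ 2 * stj 2 x)"
  have ppos: "p x > 0" if "x > 0" for x using that stj_pos[of x 2] by (simp add: p_def)
  obtain C where C: "C > 0" "((\<lambda>x. R x / p x) \<longlongrightarrow> C) at_top"
    using measure_Ioc_asymptotic[OF assms] unfolding R_def p_def by blast
  have "mono R"
  proof (rule monoI)
    fix x y :: real assume "x \<le> y"
    have "{0<..y} \<in> sets \<rho>"
      by (auto simp: sets_rho sets_restrict_space intro!: image_eqI[of _ _ "{0<..y}"])
    then show "R x \<le> R y"
      unfolding R_def measure_def using \<open>x \<le> y\<close> emeasure_rho_Ioc_finite[of y]
      by (intro enn2real_mono emeasure_mono) (auto simp: less_top)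
  qed
  then have "R \<in> borel_measurable borel" by (rule borel_measurable_mono)
  moreover have "\<forall>\<^sub>F x in at_top. 0 < R x"
    using order_tendstoD(1)[OF C(2) C(1)] eventually_gt_at_top[of 0]
    by eventually_elim (use ppos in \<open>auto simp: zero_less_divide_iff dest: less_asym\<close>)
  moreover have "((\<lambda>x. R (l * x) / R x) \<longlongrightarrow> l powr r) at_top" if l: "l > 0" for l
  proof -
    have "filterlim (\<lambda>x. l * x) at_top at_top"
      using l by (intro filterlim_tendsto_pos_mult_at_top[OF tendsto_const] filterlim_ident) auto
    from filterlim_compose[OF C(2) this]
    have Cl: "((\<lambda>x. R (l * x) / p (l * x)) \<longlongrightarrow> C) at_top" .
    have "((\<lambda>x. stj 2 (l * x) / stj 2 x) \<longlongrightarrow> l powr (r - real 2)) at_top"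
      using ratio l by (intro stj_dilation) auto
    then have "((\<lambda>x. (R (l * x) / p (l * x)) / (R x / p x) * (l ^ 2 * (stj 2 (l * x) / stj 2 x))) \<longlongrightarrow>
        C / C * (l ^ 2 * l powr (r - real 2))) at_top"
      using C by (intro tendsto_intros Cl) auto
    moreover have "C / C * (l ^ 2 * l powr (r - real 2)) = l powr r"
      using C l by (simp add: powr_diff powr_numeral)
    moreover have "\<forall>\<^sub>F x in at_top. (R (l * x) / p (l * x)) / (R x / p x) * (l ^ 2 * (stj 2 (l * x) / stj 2 x))
        = R (l * x) / R x"
      using eventually_gt_at_top[of 0]
    proof eventually_elim
      case (elim x)
      then show ?case using l stj_pos[of x 2] stj_pos[of "l * x" 2]
        by (simp add: p_def power_mult_distrib)
    qed
    ultimately show ?thesis by (simp add: Lim_transform_eventually)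
  qed
  ultimately show ?thesis by (simp add: regularly_varying_def R_def)
qed

section \<open>Orders of growth of the kernel integrals\<close>

lemma kernel_order:
  assumes ratio: "((\<lambda>x. x * stj 3 x / stj 2 x) \<longlongrightarrow> (2 - r) / 2) at_top"
  shows "((\<lambda>x. ln (x ^ 2 * stj 2 x) / ln x) \<longlongrightarrow> r) at_top"
proof (rule lhospital_at_top_at_top)
  show "filterlim (ln :: real \<Rightarrow> real) at_top at_top" by (rule ln_at_top)
  show "\<forall>\<^sub>F x::real in at_top. inverse x \<noteq> 0"
    using eventually_gt_at_top[of 0] by eventually_elim simp
  show "\<forall>\<^sub>F x::real in at_top. (ln has_real_derivative inverse x) (at x)"
    using eventually_gt_at_top[of 0] by eventually_elim (rule DERIV_ln)
  show "\<forall>\<^sub>F x in at_top. ((\<lambda>x. ln (x ^ 2 * stj 2 x)) has_real_derivative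
      inverse (x ^ 2 * stj 2 x) * (x ^ 2 * (- 2 * stj 3 x) + 2 * x * stj 2 x)) (at x)"
    using eventually_gt_at_top[of 0]
  proof eventually_elim
    case (elim x)
    have "(stj 2 has_real_derivative - 2 * stj 3 x) (at x)"
      using DERIV_stj[of x 2] elim by (simp add: eval_nat_numeral)
    then have "((\<lambda>x. x ^ 2 * stj 2 x) has_real_derivative x ^ 2 * (- 2 * stj 3 x) + 2 * x * stj 2 x) (at x)"
      by (auto intro!: derivative_eq_intros)
    then show ?case
      using elim stj_pos[of x 2] by (intro DERIV_chain2[OF DERIV_ln]) auto
  qed
  \<comment> \<open>This is x times the logarithmic derivative of \<open>x ^ 2 * stj 2 x\<close>,
    hence the quotient of derivatives in l'Hopital's rule.\<close>
  have "((\<lambda>x. 2 - 2 * (x * stj 3 x / stj 2 x)) \<longlongrightarrow> 2 - 2 * ((2 - r) / 2)) at_top"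
    by (intro tendsto_intros ratio)
  moreover have "2 - 2 * ((2 - r) / 2) = r" by (simp add: field_simps)
  ultimately have lim: "((\<lambda>x. 2 - 2 * (x * stj 3 x / stj 2 x)) \<longlongrightarrow> r) at_top" by (simp only:)
  show "((\<lambda>x. inverse (x ^ 2 * stj 2 x) * (x ^ 2 * (- 2 * stj 3 x) + 2 * x * stj 2 x) / inverse x) \<longlongrightarrow> r) at_top"
  proof (rule Lim_transform_eventually[OF lim])
    show "\<forall>\<^sub>F x in at_top. 2 - 2 * (x * stj 3 x / stj 2 x) =
        inverse (x ^ 2 * stj 2 x) * (x ^ 2 * (- 2 * stj 3 x) + 2 * x * stj 2 x) / inverse x"
      using eventually_gt_at_top[of 0]
    proof eventually_elim
      case (elim x)
      then show ?case using stj_pos[of x 2] by (simp add: field_simps power2_eq_square)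
    qed
  qed
qed

lemma integrable_kernel_powr:
  assumes "x > 0" "n \<ge> 1"
  shows "integrable \<rho> (\<lambda>t. (x / (x + t)) powr n)"
proof (rule Bochner_Integration.integrable_bound)
  show "integrable \<rho> (\<lambda>t. x * (1 / (x + t) ^ 1))"
    using assms by (intro integrable_mult_right integrable_stj) auto
  show "(\<lambda>t. (x / (x + t)) powr n) \<in> borel_measurable \<rho>"
    by (intro borel_measurable_rho) measurable
  show "AE t in \<rho>. norm ((x / (x + t)) powr n) \<le> norm (x * (1 / (x + t) ^ 1))"
  proof (rule AE_I2)
    fix t assume "t \<in> space \<rho>"
    then have "0 < x / (x + t)" "x / (x + t) \<le> 1" using assms by (auto simp: space_rho)
    then have "(x / (x + t)) powr n \<le> (x / (x + t)) powr 1"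
      using assms by (intro powr_mono') auto
    then show "norm ((x / (x + t)) powr n) \<le> norm (x * (1 / (x + t) ^ 1))"
      using \<open>0 < x / (x + t)\<close> by (simp add: abs_of_pos)
  qed
qed

text \<open>Take k with \<open>2 ^ k \<le> (x + t) / x < 2 ^ Suc k\<close>. The left side is then at
  most \<open>(2 powr - n) ^ k\<close>, while at scale \<open>2 ^ k * x\<close> the kernel is at
  least 1/3; the factor 9 compensates its square.\<close>

lemma kernel_powr_dyadic_bound:
  fixes x t n :: real
  assumes "x > 0" "t > 0" "n > 0"
  shows "\<exists>k. (x / (x + t)) powr n \<le> 9 * ((2 powr - n) ^ k * (2 ^ k * x / (2 ^ k * x + t)) ^ 2)"
proof -
  define y where "y = (x + t) / x"
  have y: "y \<ge> 1" using assms by (simp add: y_def)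
  obtain m where "y < 2 ^ m" using real_arch_pow[of 2 y] by auto
  then have least: "y < 2 ^ (LEAST m. y < 2 ^ m)" by (rule LeastI)
  then obtain k where k: "(LEAST m. y < 2 ^ m) = Suc k"
    using y by (cases "LEAST m. y < 2 ^ m") auto
  have up: "y < 2 ^ Suc k" using least k by simp
  have lo: "2 ^ k \<le> y" using not_less_Least[of k "\<lambda>m. y < 2 ^ m"] k by simp
  have "x / (x + t) = 1 / y" using assms by (simp add: y_def)
  also have "\<dots> \<le> 1 / 2 ^ k" using lo y by (intro divide_left_mono) auto
  finally have "(x / (x + t)) powr n \<le> (1 / 2 ^ k) powr n"
    using assms by (intro powr_mono2) auto
  also have "\<dots> = (2 powr - n) ^ k"
  proof -
    have "1 / 2 ^ k = 2 powr - real k" by (simp add: powr_minus powr_realpow divide_inverse)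
    moreover have "(2 powr - n) ^ k = (2 powr - n) powr real k" by (simp add: powr_realpow)
    ultimately show ?thesis by (simp add: powr_powr mult.commute)
  qed
  finally have 1: "(x / (x + t)) powr n \<le> (2 powr - n) ^ k" .
  have "x + t < 2 * (2 ^ k * x)" using up assms by (simp add: y_def field_simps)
  then have "2 ^ k * x + t \<le> 3 * (2 ^ k * x)" using assms(1) by linarith
  then have "1 / 3 \<le> 2 ^ k * x / (2 ^ k * x + t)"
    using assms by (simp add: pos_le_divide_eq add_pos_pos)
  then have "(1 / 3) ^ 2 \<le> (2 ^ k * x / (2 ^ k * x + t)) ^ 2" by (rule power_mono) simp
  then have "9 * (1 / 3) ^ 2 \<le> 9 * (2 ^ k * x / (2 ^ k * x + t)) ^ 2" by (rule mult_left_mono) simp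
  then have 2: "1 \<le> 9 * (2 ^ k * x / (2 ^ k * x + t)) ^ 2" by (simp add: power_divide)
  have "(2 powr - n) ^ k * 1 \<le> (2 powr - n) ^ k * (9 * (2 ^ k * x / (2 ^ k * x + t)) ^ 2)"
    by (intro mult_left_mono 2) auto
  also have "\<dots> = 9 * ((2 powr - n) ^ k * (2 ^ k * x / (2 ^ k * x + t)) ^ 2)" by (rule mult.left_commute)
  finally show ?thesis using 1 by (intro exI[of _ k]) linarith
qed

text \<open>Summing the dyadic bound over k gives a series in \<open>p (2 ^ k * x)\<close>. Doubling
  x eventually multiplies p by at most A, so the series is dominated by a geometric one with ratio
  \<open>q * A\<close>.\<close>

lemma kernel_powr_upper_bound:
  assumes n: "n > 1" and r: "r \<le> 1"
    and ratio: "((\<lambda>x. x * stj 3 x / stj 2 x) \<longlongrightarrow> (2 - r) / 2) at_top"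
  shows "\<exists>C. \<forall>\<^sub>F x in at_top. (LINT t|\<rho>. (x / (x + t)) powr n) \<le> C * (x ^ 2 * stj 2 x)"
proof -
  define p where "p = (\<lambda>x. x ^ 2 * stj 2 x)"
  have ppos: "p x > 0" if "x > 0" for x using that stj_pos[of x 2] by (simp add: p_def)
  \<comment> \<open>The exponent is the midpoint of 1 and n: A exceeds \<open>2 powr r\<close>, the
    asymptotic doubling factor of p, and stays below \<open>2 powr n\<close>, which makes
    \<open>q * A < 1\<close>.\<close>
  define A where "A = 2 powr ((1 + n) / 2)"
  define q where "q = 2 powr - n"
  have qA: "0 < q" "0 < A" "q * A < 1"
    using n powr_less_mono[of "- n + (1 + n) / 2" 0 2] by (simp_all add: q_def A_def flip: powr_add)
  have "((\<lambda>x. stj 2 (2 * x) / stj 2 x) \<longlongrightarrow> 2 powr (r - real 2)) at_top"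
    using ratio by (intro stj_dilation) auto
  then have "((\<lambda>x. 4 * (stj 2 (2 * x) / stj 2 x)) \<longlongrightarrow> 4 * 2 powr (r - real 2)) at_top"
    by (intro tendsto_intros)
  moreover have "4 * 2 powr (r - real 2) < A"
  proof -
    have "4 * 2 powr (r - real 2) = 2 powr r" by (simp add: powr_diff powr_numeral)
    also have "\<dots> < A" unfolding A_def using n r by (intro powr_less_mono) auto
    finally show ?thesis .
  qed
  ultimately have "\<forall>\<^sub>F x in at_top. 4 * (stj 2 (2 * x) / stj 2 x) < A"
    by (rule order_tendstoD(2))
  then have "\<forall>\<^sub>F x in at_top. p (2 * x) \<le> A * p x"
    using eventually_gt_at_top[of 0]
  proof eventually_elim
    case (elim x)
    then have "4 * stj 2 (2 * x) \<le> A * stj 2 x"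
      using stj_pos[of x 2] by (simp add: field_simps)
    then have "x ^ 2 * (4 * stj 2 (2 * x)) \<le> x ^ 2 * (A * stj 2 x)" by (intro mult_left_mono) auto
    then show ?case by (simp add: p_def algebra_simps)
  qed
  then obtain X where X: "\<And>x. x \<ge> X \<Longrightarrow> p (2 * x) \<le> A * p x"
    by (auto simp: eventually_at_top_linorder)
  have pk: "p (2 ^ k * x) \<le> A ^ k * p x" if "x \<ge> X" "x > 0" for k x
  proof (induction k)
    case (Suc k)
    have "1 * x \<le> 2 ^ k * x" using that by (intro mult_right_mono) (auto simp: one_le_power)
    then have "X \<le> 2 ^ k * x" using that(1) by linarith
    then have "p (2 * (2 ^ k * x)) \<le> A * p (2 ^ k * x)" by (rule X)
    also have "\<dots> \<le> A * (A ^ k * p x)" using Suc qA by (intro mult_left_mono) auto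
    finally show ?case by (simp add: mult_ac)
  qed simp
  have "(LINT t|\<rho>. (x / (x + t)) powr n) \<le> 9 / (1 - q * A) * p x" if x: "x \<ge> X" "x > 0" for x
  proof -
    define g where "g = (\<lambda>k t. 9 * (q ^ k * (2 ^ k * x / (2 ^ k * x + t)) ^ 2))"
    have "ennreal (LINT t|\<rho>. (x / (x + t)) powr n) = (\<integral>\<^sup>+t. ennreal ((x / (x + t)) powr n) \<partial>\<rho>)"
      using x n by (intro nn_integral_eq_integral[symmetric] integrable_kernel_powr) auto
    also have "\<dots> \<le> (\<integral>\<^sup>+t. (\<Sum>k. ennreal (g k t)) \<partial>\<rho>)"
    proof (rule nn_integral_mono)
      fix t assume "t \<in> space \<rho>"
      then have "t > 0" by (simp add: space_rho)
      then obtain k where "(x / (x + t)) powr n \<le> g k t"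
        using kernel_powr_dyadic_bound[of x t n] x n unfolding g_def q_def by auto
      then have "ennreal ((x / (x + t)) powr n) \<le> sum (\<lambda>k. ennreal (g k t)) {k}"
        by (simp add: ennreal_leI)
      also have "\<dots> \<le> (\<Sum>k. ennreal (g k t))" by (intro sum_le_suminf) auto
      finally show "ennreal ((x / (x + t)) powr n) \<le> (\<Sum>k. ennreal (g k t))" .
    qed
    also have "\<dots> = (\<Sum>k. \<integral>\<^sup>+t. ennreal (g k t) \<partial>\<rho>)"
      unfolding g_def by (intro nn_integral_suminf measurable_compose[OF _ measurable_ennreal] borel_measurable_rho) measurable
    also have "\<dots> = (\<Sum>k. ennreal (9 * (q ^ k * p (2 ^ k * x))))"
    proof (rule arg_cong[of _ _ suminf], rule ext)
      fix k
      have xk: "2 ^ k * x > 0" using x by simp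
      have int: "integrable \<rho> (\<lambda>t. (2 ^ k * x / (2 ^ k * x + t)) ^ 2)"
        using integrable_kernel[OF xk, of "\<lambda>_. 1" 1] by simp
      have "(\<integral>\<^sup>+t. ennreal (g k t) \<partial>\<rho>) = ennreal (LINT t|\<rho>. g k t)"
        unfolding g_def using qA by (intro nn_integral_eq_integral integrable_mult_right int) auto
      also have "(LINT t|\<rho>. g k t) = 9 * (q ^ k * p (2 ^ k * x))"
        unfolding g_def p_def by (simp only: integral_mult_right_zero kernel_integral)
      finally show "(\<integral>\<^sup>+t. ennreal (g k t) \<partial>\<rho>) = ennreal (9 * (q ^ k * p (2 ^ k * x)))" .
    qed
    also have "\<dots> \<le> (\<Sum>k. ennreal (9 * p x * (q * A) ^ k))"
    proof (intro suminf_le ennreal_leI)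
      fix k
      have "q ^ k * p (2 ^ k * x) \<le> q ^ k * (A ^ k * p x)"
        using qA x by (intro mult_left_mono pk) auto
      then show "9 * (q ^ k * p (2 ^ k * x)) \<le> 9 * p x * (q * A) ^ k"
        by (simp add: power_mult_distrib mult_ac)
    qed auto
    also have "\<dots> = ennreal (9 * p x * (1 / (1 - q * A)))"
    proof (rule suminf_ennreal_eq)
      show "0 \<le> 9 * p x * (q * A) ^ k" for k using qA ppos[of x] x by simp
      show "(\<lambda>k. 9 * p x * (q * A) ^ k) sums (9 * p x * (1 / (1 - q * A)))"
        using qA by (intro sums_mult geometric_sums) (auto simp: abs_mult)
    qed
    finally show ?thesis
      using qA ppos[of x] x by (subst (asm) ennreal_le_iff) auto
  qed
  note bound = this
  have "\<forall>\<^sub>F x in at_top. (LINT t|\<rho>. (x / (x + t)) powr n) \<le> 9 / (1 - q * A) * (x ^ 2 * stj 2 x)"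
    using eventually_gt_at_top[of 0] eventually_ge_at_top[of X]
  proof eventually_elim
    case (elim x)
    then show ?case using bound[of x] by (simp only: p_def)
  qed
  then show ?thesis by blast
qed

text \<open>On (0, x] the base \<open>x / (x + t)\<close> is at least 1/2.\<close>

lemma kernel_powr_lower_bound:
  assumes n: "n > 1" and x: "x > 0"
  shows "2 powr - n * measure \<rho> {0<..x} \<le> (LINT t|\<rho>. (x / (x + t)) powr n)"
proof -
  have sets: "{0<..x} \<in> sets \<rho>"
    by (auto simp: sets_rho sets_restrict_space intro!: image_eqI[of _ _ "{0<..x}"])
  have "2 powr - n * measure \<rho> {0<..x} = (LINT t|\<rho>. 2 powr - n * indicator {0<..x} t)"
    using sets.sets_into_space[OF sets] by (simp add: Int_absorb2)
  also have "\<dots> \<le> (LINT t|\<rho>. (x / (x + t)) powr n)"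
  proof (intro integral_mono integrable_mult_right integrable_kernel_powr)
    show "integrable \<rho> (indicat_real {0<..x})"
      by (intro integrable_real_indicator sets emeasure_rho_Ioc_finite)
    fix t assume "t \<in> space \<rho>"
    show "2 powr - n * indicator {0<..x} t \<le> (x / (x + t)) powr n"
    proof (cases "t \<in> {0<..x}")
      case True
      have "2 powr - n = (1 / 2) powr n" by (simp add: powr_divide powr_minus_divide)
      also have "\<dots> \<le> (x / (x + t)) powr n"
        using True n x by (intro powr_mono2) (auto simp: field_simps)
      finally show ?thesis using True by simp
    qed simp
  qed (use n x in auto)
  finally show ?thesis .
qed

text \<open>The integral lies eventually between positive multiples of
  \<open>x ^ 2 * stj 2 x\<close>. Constant factors disappear after dividing logarithms by
  \<open>ln x\<close>, so the upper order is even a limit.\<close>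

lemma upper_order_kernel_powr:
  assumes r: "0 \<le> r" "r \<le> 1" and n: "n > 1"
    and ratio: "((\<lambda>x. x * stj 3 x / stj 2 x) \<longlongrightarrow> (2 - r) / 2) at_top"
  shows "upper_order (\<lambda>x. LINT t|\<rho>. (x / (x + t)) powr n) = ereal r"
proof -
  define p where "p = (\<lambda>x. x ^ 2 * stj 2 x)"
  define G where "G = (\<lambda>x. LINT t|\<rho>. (x / (x + t)) powr n)"
  have ppos: "p x > 0" if "x > 0" for x using that stj_pos[of x 2] by (simp add: p_def)
  have ord: "((\<lambda>x. ln (p x) / ln x) \<longlongrightarrow> r) at_top" using kernel_order[OF ratio] by (simp add: p_def)
  obtain C where C: "C > 0" "((\<lambda>x. measure \<rho> {0<..x} / p x) \<longlongrightarrow> C) at_top"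
    using measure_Ioc_asymptotic[OF r ratio] unfolding p_def by blast
  define b where "b = 2 powr - n * (C / 2)"
  have b: "b > 0" using C by (simp add: b_def)
  obtain B' where B': "\<forall>\<^sub>F x in at_top. G x \<le> B' * p x"
    using kernel_powr_upper_bound[OF n r(2) ratio] unfolding p_def G_def by blast
  \<comment> \<open>The maximum with 1 ensures a positive constant, so that
    \<open>ln (B * p x)\<close> splits.\<close>
  define B where "B = max B' 1"
  have B: "B > 0" by (simp add: B_def)
  have "\<forall>\<^sub>F x in at_top. C / 2 < measure \<rho> {0<..x} / p x"
    using C by (intro order_tendstoD(1)[OF C(2)]) auto
  then have lo: "\<forall>\<^sub>F x in at_top. b * p x \<le> G x"
    using eventually_gt_at_top[of 0]
  proof eventually_elim
    case (elim x)
    have "C / 2 * p x \<le> measure \<rho> {0<..x}" using elim ppos[of x] by (simp add: pos_less_divide_eq less_imp_le)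
    then have "2 powr - n * (C / 2 * p x) \<le> 2 powr - n * measure \<rho> {0<..x}" by (intro mult_left_mono) auto
    also have "\<dots> \<le> G x" unfolding G_def using n elim by (intro kernel_powr_lower_bound)
    finally show ?case by (simp add: b_def mult.assoc)
  qed
  have const: "((\<lambda>x. ln c / ln x + ln (p x) / ln x) \<longlongrightarrow> 0 + r) at_top" for c
    by (intro tendsto_add ord tendsto_divide_0[OF tendsto_const] filterlim_at_top_imp_at_infinity ln_at_top)
  have "((\<lambda>x. ln (G x) / ln x) \<longlongrightarrow> r) at_top"
  proof (rule tendsto_sandwich)
    show "((\<lambda>x. ln b / ln x + ln (p x) / ln x) \<longlongrightarrow> r) at_top" using const by simp
    show "((\<lambda>x. ln B / ln x + ln (p x) / ln x) \<longlongrightarrow> r) at_top" using const by simp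
    show "\<forall>\<^sub>F x in at_top. ln b / ln x + ln (p x) / ln x \<le> ln (G x) / ln x"
      using lo eventually_gt_at_top[of 1]
    proof eventually_elim
      case (elim x)
      have "ln (b * p x) \<le> ln (G x)" using elim b ppos[of x] by (intro ln_mono) auto
      then have "ln b + ln (p x) \<le> ln (G x)" using b ppos[of x] elim by (simp add: ln_mult)
      then show ?case using elim by (simp add: divide_right_mono flip: add_divide_distrib)
    qed
    show "\<forall>\<^sub>F x in at_top. ln (G x) / ln x \<le> ln B / ln x + ln (p x) / ln x"
      using lo B' eventually_gt_at_top[of 1]
    proof eventually_elim
      case (elim x)
      have "0 < G x" using elim b ppos[of x] mult_pos_pos[of b "p x"] by linarith
      moreover have "B' * p x \<le> B * p x"
        using ppos[of x] elim by (intro mult_right_mono) (auto simp: B_def)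
      ultimately have "ln (G x) \<le> ln (B * p x)" using elim by (intro ln_mono) auto
      then have "ln (G x) \<le> ln B + ln (p x)" using B ppos[of x] elim by (simp add: ln_mult)
      then show ?case using elim by (simp add: divide_right_mono flip: add_divide_distrib)
    qed
  qed
  then have "((\<lambda>x. ereal (ln (G x) / ln x)) \<longlongrightarrow> ereal r) at_top" by (simp add: tendsto_ereal)
  then show ?thesis
    unfolding upper_order_def G_def by (intro lim_imp_Limsup) simp_all
qed

end

section \<open>The price maximizing the optimal proportion\<close>

context half_line_measure
begin

text \<open>With \<open>g = stj 1\<close>, \<open>s = c + \<xi>\<close>, \<open>K = E - \<xi>\<close> and \<open>d = E - m\<close>, the optimal proportion at the price
  \<open>u = d - g s\<close> is \<open>share K d s\<close>, and \<open>crit K s\<close> is the \<open>d\<close> for which it is maximal at \<open>s\<close>.\<close>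

definition share :: "real \<Rightarrow> real \<Rightarrow> real \<Rightarrow> real" where
  "share K d s = (d - stj 1 s) / (s + K - stj 1 s)"

definition crit :: "real \<Rightarrow> real \<Rightarrow> real" where
  "crit K s = (stj 1 s + (s + K) * stj 2 s) / (1 + stj 2 s)"

lemma DERIV_stj_1: "s > 0 \<Longrightarrow> (stj 1 has_real_derivative - stj 2 s) (at s)"
  using DERIV_stj[of s 1] by (simp add: numeral_2_eq_2)

lemma DERIV_stj_2: "s > 0 \<Longrightarrow> (stj 2 has_real_derivative - 2 * stj 3 s) (at s)"
  using DERIV_stj[of s 2] by (simp add: eval_nat_numeral)

lemma crit_mult: "s > 0 \<Longrightarrow> crit K s * (1 + stj 2 s) = stj 1 s + (s + K) * stj 2 s"
  using stj_pos[of s 2] by (simp add: crit_def)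

text \<open>The numerator of the quotient rule factors, so the derivative has the sign of
  \<open>crit K s - d\<close>.\<close>

lemma DERIV_share:
  assumes "s > 0" "s + K - stj 1 s \<noteq> 0"
  shows "(share K d has_real_derivative (1 + stj 2 s) * (crit K s - d) / (s + K - stj 1 s) ^ 2) (at s)"
proof -
  have "(share K d has_real_derivative
      ((0 - - stj 2 s) * (s + K - stj 1 s) - (d - stj 1 s) * (1 + 0 - - stj 2 s)) /
      ((s + K - stj 1 s) * (s + K - stj 1 s))) (at s)"
    unfolding share_def using assms
    by (intro DERIV_divide DERIV_diff DERIV_add DERIV_ident DERIV_const DERIV_stj_1)
  moreover have "(0 - - stj 2 s) * (s + K - stj 1 s) - (d - stj 1 s) * (1 + 0 - - stj 2 s)
      = (1 + stj 2 s) * (crit K s - d)"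
    using crit_mult[OF assms(1), of K] by (simp add: algebra_simps)
  ultimately show ?thesis by (simp add: power2_eq_square)
qed

lemma DERIV_crit:
  assumes "s > 0"
  shows "(crit K has_real_derivative - (2 * stj 3 s * (s + K - crit K s) / (1 + stj 2 s))) (at s)"
proof -
  have nz: "1 + stj 2 s \<noteq> 0" using stj_pos[of s 2] assms by simp
  have "(crit K has_real_derivative
      ((- stj 2 s + ((1 + 0) * stj 2 s + (- 2 * stj 3 s) * (s + K))) * (1 + stj 2 s) -
        (stj 1 s + (s + K) * stj 2 s) * (0 + - 2 * stj 3 s)) / ((1 + stj 2 s) * (1 + stj 2 s))) (at s)"
    unfolding crit_def using nz assms
    by (intro DERIV_divide DERIV_add DERIV_mult DERIV_ident DERIV_const DERIV_stj_1 DERIV_stj_2)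
  moreover have "(- stj 2 s + ((1 + 0) * stj 2 s + (- 2 * stj 3 s) * (s + K))) * (1 + stj 2 s) -
        (stj 1 s + (s + K) * stj 2 s) * (0 + - 2 * stj 3 s)
      = - (2 * stj 3 s * (s + K - crit K s)) * (1 + stj 2 s)"
    unfolding crit_mult[OF assms, symmetric] by (simp add: algebra_simps)
  ultimately show ?thesis using nz by simp
qed

lemma crit_identities:
  assumes "s > 0"
  shows "s + K - crit K s = (s + K - stj 1 s) / (1 + stj 2 s)"
    and "crit K s - stj 1 s = stj 2 s * (s + K - crit K s)"
proof -
  have "1 + stj 2 s > 0" using stj_pos[of s 2] assms by simp
  then show "s + K - crit K s = (s + K - stj 1 s) / (1 + stj 2 s)"
    using crit_mult[OF assms, of K] by (simp add: field_simps)
  show "crit K s - stj 1 s = stj 2 s * (s + K - crit K s)"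
    using crit_mult[OF assms, of K] by (simp add: algebra_simps)
qed

text \<open>The sign of the derivative of \<open>crit K\<close> depends on
  \<open>s + K - crit K s\<close>, so global monotonicity is not at hand. At a fixed level d < K,
  clearing the denominator of \<open>crit K s - d\<close> gives a function h with derivative
  \<open>- 2 * stj 3 s * (s + K - d) < 0\<close>; hence the level is crossed at most once,
  downwards.\<close>

lemma crit_compare:
  assumes s: "0 < s" "s < y" and "d < K"
  shows "crit K y \<ge> d \<Longrightarrow> crit K s > d"
proof -
  define h where "h = (\<lambda>s. stj 1 s + (s + (K - d)) * stj 2 s - d)"
  have h: "h s = (1 + stj 2 s) * (crit K s - d)" if "s > 0" for s
    using crit_mult[OF that, of K] by (simp add: h_def algebra_simps)
  have "h y < h s"
  proof (rule DERIV_neg_imp_decreasing[OF s(2)])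
    fix x assume x: "s \<le> x" "x \<le> y"
    then have x0: "x > 0" using s by simp
    have "(h has_real_derivative - stj 2 x + ((1 + 0) * stj 2 x + (- 2 * stj 3 x) * (x + (K - d))) - 0) (at x)"
      unfolding h_def using x0
      by (intro DERIV_diff DERIV_add DERIV_mult DERIV_ident DERIV_const DERIV_stj_1 DERIV_stj_2)
    moreover have "0 < stj 3 x * (x + (K - d))"
      using x0 assms stj_pos[of x 3] by simp
    then have "- stj 2 x + ((1 + 0) * stj 2 x + (- 2 * stj 3 x) * (x + (K - d))) - 0 < 0" by (simp add: mult.commute)
    ultimately show "\<exists>D. (h has_real_derivative D) (at x) \<and> D < 0" by blast
  qed
  moreover assume "crit K y \<ge> d"
  then have "h y \<ge> 0" using h[of y] stj_pos[of y 2] s by simp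
  ultimately have "0 < h s" by simp
  then show "crit K s > d" using h[of s] stj_pos[of s 2] s by (simp add: zero_less_mult_iff)
qed

lemma share_strict_increasing:
  assumes "0 < s" "s < y" "d < K" "stj 1 s < d" "crit K y \<ge> d"
  shows "share K d s < share K d y"
proof -
  have dom: "x + K - stj 1 x > 0" if "s \<le> x" for x
    using that assms stj_strict_antimono[of s x 1] by (cases "x = s") auto
  have der: "(share K d has_real_derivative (1 + stj 2 x) * (crit K x - d) / (x + K - stj 1 x) ^ 2) (at x)"
    if "s \<le> x" for x
    using dom[OF that] that assms by (intro DERIV_share) auto
  \<comment> \<open>Positivity is needed only inside the interval: the derivative vanishes at y when
    \<open>crit K y = d\<close>.\<close>
  show ?thesis
  proof (rule DERIV_pos_imp_increasing_open[OF assms(2)])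
    fix x assume x: "s < x" "x < y"
    have "crit K x > d" using x assms by (intro crit_compare[of x y]) auto
    then have "(1 + stj 2 x) * (crit K x - d) / (x + K - stj 1 x) ^ 2 > 0"
      using dom[of x] x assms stj_pos[of x 2] by (intro divide_pos_pos mult_pos_pos) auto
    then show "\<exists>D. (share K d has_real_derivative D) (at x) \<and> D > 0" using der[of x] x by auto
  qed (use der in \<open>auto intro!: continuous_at_imp_continuous_on DERIV_isCont\<close>)
qed

lemma share_strict_decreasing:
  assumes "0 < s" "s < y" "d < K" "stj 1 s < d" "crit K s \<le> d"
  shows "share K d y < share K d s"
proof -
  have dom: "x + K - stj 1 x > 0" if "s \<le> x" for x
    using that assms stj_strict_antimono[of s x 1] by (cases "x = s") auto
  have der: "(share K d has_real_derivative (1 + stj 2 x) * (crit K x - d) / (x + K - stj 1 x) ^ 2) (at x)"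
    if "s \<le> x" for x
    using dom[OF that] that assms by (intro DERIV_share) auto
  show ?thesis
  proof (rule DERIV_neg_imp_decreasing_open[OF assms(2)])
    fix x assume x: "s < x" "x < y"
    have "crit K x < d" using x assms crit_compare[of s x d K] by (cases "crit K x < d") auto
    then have "(1 + stj 2 x) * (crit K x - d) / (x + K - stj 1 x) ^ 2 < 0"
      using dom[of x] x assms stj_pos[of x 2] by (intro divide_neg_pos mult_pos_neg) auto
    then show "\<exists>D. (share K d has_real_derivative D) (at x) \<and> D < 0" using der[of x] x by auto
  qed (use der in \<open>auto intro!: continuous_at_imp_continuous_on DERIV_isCont\<close>)
qed

lemma tendsto_crit: "(crit K \<longlongrightarrow> 0) at_top"
proof -
  have "((\<lambda>s. (stj 1 s + (s * stj 2 s + K * stj 2 s)) / (1 + stj 2 s)) \<longlongrightarrow> (0 + (0 + K * 0)) / (1 + 0)) at_top"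
    by (intro tendsto_intros tendsto_stj_1 tendsto_stj_2 tendsto_mult_stj_2) auto
  then show ?thesis by (simp add: crit_def[abs_def] distrib_right)
qed

text \<open>The ceiling \<open>stj 1 1\<close> avoids the behaviour of \<open>stj 1\<close> near 0.
  It suffices because only small values of \<open>E - m\<close> occur in the limit.\<close>

lemma stj_1_onto:
  assumes "0 < y" "y \<le> stj 1 1"
  obtains s where "s > 0" "stj 1 s = y"
proof -
  have "\<forall>\<^sub>F s in at_top. stj 1 s < y \<and> s > 1"
    using order_tendstoD(2)[OF tendsto_stj_1 assms(1)] eventually_gt_at_top[of 1]
    by eventually_elim auto
  from eventually_happens[OF this] obtain b where b: "stj 1 b < y" "b > 1" by auto
  have "\<exists>s. 1 \<le> s \<and> s \<le> b \<and> stj 1 s = y"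
    using b assms by (intro IVT2) (auto intro: isCont_stj)
  then obtain s where "1 \<le> s" "stj 1 s = y" by blast
  then show ?thesis by (intro that[of s]) auto
qed

end

section \<open>Optimal proportions of a game with finite mean\<close>

locale finite_mean_game = half_line_measure +
  fixes I :: "real set" and a F :: "real \<Rightarrow> real" and E \<xi> :: real
  assumes prob: "prob_space (stieltjes_on I F)"
    and a_meas: "a \<in> borel_measurable (stieltjes_on I F)"
    and a_ge: "AE x in stieltjes_on I F. \<xi> \<le> a x"
    and xi: "game_xi I a F = \<xi>"
    and mean: "game_mean I a F = ereal E"
    and xi_less_E: "\<xi> < E"
    and Psi: "\<And>c. c > - \<xi> \<Longrightarrow> game_Psi I a F c = E - stj 1 (c + \<xi>)"
begin

text \<open>With this c the denominator is \<open>t * (a x + c)\<close> and the numerator is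
  \<open>(a x + c) - u / t\<close>. A zero of the integral therefore means
  \<open>game_Psi I a F c = m + u\<close>.\<close>

lemma optimality_integral:
  assumes "t > 0" "u > 0" "c = u / t - m - u" "c > - \<xi>"
  shows "(LINT x|stieltjes_on I F. (a x - m - u) / ((a x - m) * t - t * u + u)) =
    (1 / t) * (1 - (u / t) * (LINT x|stieltjes_on I F. 1 / (a x + c)))"
proof -
  interpret M: prob_space "stieltjes_on I F" by (rule prob)
  have int: "integrable (stieltjes_on I F) (\<lambda>x. 1 / (a x + c))"
  proof (rule M.integrable_const_bound)
    show "AE x in stieltjes_on I F. norm (1 / (a x + c)) \<le> 1 / (\<xi> + c)"
      using a_ge by eventually_elim (use assms in \<open>auto simp: divide_simps\<close>)
  qed (use a_meas in measurable)
  have "(LINT x|stieltjes_on I F. (a x - m - u) / ((a x - m) * t - t * u + u)) =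
      (LINT x|stieltjes_on I F. (1 / t) * (1 - (u / t) * (1 / (a x + c))))"
  proof (rule integral_cong_AE)
    show "AE x in stieltjes_on I F. (a x - m - u) / ((a x - m) * t - t * u + u) = (1 / t) * (1 - (u / t) * (1 / (a x + c)))"
      using a_ge
    proof eventually_elim
      case (elim x)
      then have nz: "a x + c \<noteq> 0" using assms by simp
      have "(a x - m) * t - t * u + u = t * (a x + c)" "a x - m - u = (a x + c) - u / t"
        using assms(1) unfolding assms(3) by (simp_all add: field_simps)
      moreover have "(A - w) / (t * A) = (1 / t) * (1 - w * (1 / A))" if "A \<noteq> 0" for A w
        using that assms(1) by (simp add: field_simps)
      ultimately show ?case using nz by (simp only: not_False_eq_True)
    qed
  qed (use a_meas in measurable)
  also have "\<dots> = (1 / t) * (1 - (u / t) * (LINT x|stieltjes_on I F. 1 / (a x + c)))"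
  proof -
    have "(LINT x|stieltjes_on I F. 1 - (u / t) * (1 / (a x + c))) =
        (LINT x|stieltjes_on I F. 1) - (LINT x|stieltjes_on I F. (u / t) * (1 / (a x + c)))"
      by (intro Bochner_Integration.integral_diff integrable_mult_right int M.integrable_const)
    then show ?thesis by (simp only: integral_mult_right_zero) (simp add: M.prob_space)
  qed
  finally show ?thesis .
qed

text \<open>The upper bound on t is exactly \<open>c > - \<xi>\<close>, where \<Psi> is given by
  \<open>stj 1\<close>. At the price \<open>E - m - stj 1 s\<close> the optimality equation becomes
  \<open>stj 1 (c + \<xi>) = stj 1 s\<close>, and injectivity gives
  \<open>c = s - \<xi>\<close>.\<close>

lemma opt_prop_eq:
  assumes m: "\<xi> < m" and s: "s > 0" "stj 1 s < E - m"
  shows "opt_prop I a F m (E - m - stj 1 s) = share (E - \<xi>) (E - m) s"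
proof -
  define u where "u = E - m - stj 1 s"
  have u: "u > 0" using s by (simp add: u_def)
  \<comment> \<open>The relation \<open>c = u / t - m - u\<close>, solved for t at
    \<open>c = s - \<xi>\<close>.\<close>
  define t0 where "t0 = u / (s - \<xi> + m + u)"
  have sh: "share (E - \<xi>) (E - m) s = t0"
    by (simp add: share_def t0_def u_def algebra_simps)
  have iff: "(LINT x|stieltjes_on I F. (a x - m - u) / ((a x - m) * t - t * u + u)) = 0 \<longleftrightarrow> t = t0"
    if t: "t \<in> {0<..<u / (u + m - \<xi>)}" for t
  proof -
    define c where "c = u / t - m - u"
    have "t * (u + m - \<xi>) < u" using t m u by (simp add: pos_less_divide_eq)
    then have "u + m - \<xi> < u / t" using t by (simp add: pos_less_divide_eq mult.commute)
    then have c: "c > - \<xi>" by (simp add: c_def)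
    have "(LINT x|stieltjes_on I F. (a x - m - u) / ((a x - m) * t - t * u + u)) = 0 \<longleftrightarrow>
        (u / t) * (LINT x|stieltjes_on I F. 1 / (a x + c)) = 1"
      using optimality_integral[of t u c m] c t u by (auto simp: c_def)
    also have "\<dots> \<longleftrightarrow> 1 / (LINT x|stieltjes_on I F. 1 / (a x + c)) = u / t"
      using t u by (auto simp: field_simps)
    also have "\<dots> \<longleftrightarrow> game_Psi I a F c = m + u"
      unfolding game_Psi_def by (auto simp: c_def)
    also have "\<dots> \<longleftrightarrow> stj 1 (c + \<xi>) = stj 1 s"
      unfolding Psi[OF c] by (auto simp: u_def)
    also have "\<dots> \<longleftrightarrow> c + \<xi> = s"
      using stj_strict_antimono[of s "c + \<xi>" 1] stj_strict_antimono[of "c + \<xi>" s 1] s c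
      by (cases s "c + \<xi>" rule: linorder_cases) auto
    also have "\<dots> \<longleftrightarrow> t = t0"
      using t u m s unfolding c_def t0_def by (auto simp: field_simps)
    finally show ?thesis .
  qed
  have "t0 \<in> {0<..<u / (u + m - \<xi>)}"
    using u m s by (auto simp: t0_def intro!: divide_strict_left_mono mult_pos_pos)
  then have "opt_prop I a F m u = t0"
    unfolding opt_prop_def xi using iff by (intro the_equality) blast+
  then show ?thesis using sh by (simp add: u_def)
qed

text \<open>The price \<open>u = d - stj 1 s\<close> increases with s, so monotonicity of
  \<open>share\<close> on either side of s0 carries over to the proportion as a function of u. The
  bound by \<open>stj 1 1\<close> makes every price between 0 and d of this form.\<close>

lemma u_max_eq:
  assumes s0: "s0 > 0" and d: "d = crit (E - \<xi>) s0" "d < E - \<xi>" "d \<le> stj 1 1"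
  shows "u_max I a F (E - d) = d - stj 1 s0" and "stj 1 s0 < d"
proof -
  define K where "K = E - \<xi>"
  define v where "v = d - stj 1 s0"
  define m where "m = E - d"
  have K: "d = crit K s0" "d < K" using d by (simp_all add: K_def)
  have m: "\<xi> < m" "E - m = d" using d by (simp_all add: m_def)
  show v0: "stj 1 s0 < d"
  proof -
    have "0 < stj 2 s0 * (s0 + K - crit K s0)" using K stj_pos[OF s0, of 2] s0 by simp
    then show ?thesis using crit_identities(2)[OF s0, of K] K by linarith
  qed
  have "\<exists>s>0. stj 1 s = d - u" if "0 < u" "u < d" for u
  proof -
    have "0 < d - u" "d - u \<le> stj 1 1" using that d by auto
    then obtain s where "s > 0" "stj 1 s = d - u" by (rule stj_1_onto)
    then show ?thesis by blast
  qed
  then obtain S where S: "\<And>u. 0 < u \<Longrightarrow> u < d \<Longrightarrow> S u > 0" "\<And>u. 0 < u \<Longrightarrow> u < d \<Longrightarrow> stj 1 (S u) = d - u"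
    by metis
  have opt: "opt_prop I a F m u = share K d (S u)" if "0 < u" "u < d" for u
    using opt_prop_eq[OF m(1), of "S u"] S[OF that] that by (simp add: m(2) K_def)
  have less: "x < y" if "stj 1 y < stj 1 x" "x > 0" "y > 0" for x y
    using that stj_strict_antimono[of y x 1] by (cases x y rule: linorder_cases) auto
  have up: "opt_prop I a F m u < opt_prop I a F m w" if "0 < u" "u < w" "w < v" for u w
  proof -
    have w: "w < d" using that stj_pos[OF s0, of 1] by (simp add: v_def)
    have 1: "S u < S w" by (rule less) (use that w S[of u] S[of w] in auto)
    have 2: "S w < s0" by (rule less) (use that w S[of w] s0 in \<open>auto simp: v_def\<close>)
    have "share K d (S u) < share K d (S w)"
    proof (rule share_strict_increasing)
      show "d \<le> crit K (S w)"
        using crit_compare[of "S w" s0 d K] K 2 S[of w] that w by auto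
    qed (use 1 S[of u] that w K in auto)
    then show ?thesis using opt that w by auto
  qed
  have down: "opt_prop I a F m w < opt_prop I a F m u" if "v < u" "u < w" "w < d" for u w
  proof -
    have u: "u > 0" using that v0 by (simp add: v_def)
    have 1: "S u < S w" by (rule less) (use that u S[of u] S[of w] in auto)
    have 2: "s0 < S u" by (rule less) (use that u S[of u] s0 in \<open>auto simp: v_def\<close>)
    have "share K d (S w) < share K d (S u)"
    proof (rule share_strict_decreasing)
      show "crit K (S u) \<le> d"
        using crit_compare[of s0 "S u" d K] K 2 s0 by force
    qed (use 1 S[of u] that u K in auto)
    then show ?thesis using opt that u by auto
  qed
  have bound: "ereal w < game_mean I a F - ereal m \<longleftrightarrow> w < d" for w
    using m(2) by (simp add: mean)
  have "u_max I a F m = v"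
    unfolding u_max_def bound
  proof (rule the_equality)
    show "0 < v \<and> v < d \<and> strict_mono_on {0<..<v} (opt_prop I a F m) \<and>
        strict_antimono_on {u. v < u \<and> u < d} (opt_prop I a F m)"
      using up down v0 stj_pos[OF s0, of 1] by (auto simp: v_def monotone_on_def)
    fix w assume w: "0 < w \<and> w < d \<and> strict_mono_on {0<..<w} (opt_prop I a F m) \<and>
        strict_antimono_on {u. w < u \<and> u < d} (opt_prop I a F m)"
    show "w = v"
    proof (rule ccontr)
      assume "w \<noteq> v"
      \<comment> \<open>Between two distinct turning points the proportion would be both increasing
        and decreasing; the points at one third and two thirds of the gap show the clash.\<close>
      have "\<exists>x y. x < y \<and> opt_prop I a F m x < opt_prop I a F m y \<and> opt_prop I a F m y < opt_prop I a F m x"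
      proof (cases "w < v")
        case True
        define x where "x = w + (v - w) / 3"
        define y where "y = w + 2 * (v - w) / 3"
        have xy: "w < x" "x < y" "y < v" using True by (auto simp: x_def y_def field_simps)
        have "v < d" using stj_pos[OF s0, of 1] by (simp add: v_def)
        then have "opt_prop I a F m y < opt_prop I a F m x"
          using w xy by (auto simp: monotone_on_def)
        moreover have "opt_prop I a F m x < opt_prop I a F m y" using up[of x y] xy w by auto
        ultimately show ?thesis using xy by blast
      next
        case False
        define x where "x = v + (w - v) / 3"
        define y where "y = v + 2 * (w - v) / 3"
        have xy: "v < x" "x < y" "y < w" using False \<open>w \<noteq> v\<close> by (auto simp: x_def y_def field_simps)
        have "v > 0" using v0 by (simp add: v_def)
        then have "opt_prop I a F m x < opt_prop I a F m y"
          using w xy by (auto simp: monotone_on_def)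
        moreover have "opt_prop I a F m y < opt_prop I a F m x" using down[of x y] xy w by auto
        ultimately show ?thesis using xy by blast
      qed
      then show False by (auto dest: less_asym)
    qed
  qed
  then show "u_max I a F (E - d) = d - stj 1 s0" by (simp add: m_def v_def)
qed

text \<open>Beyond s1 both size conditions of \<open>u_max_eq\<close> hold, so every s there
  determines a game whose maximizing price is known.\<close>

lemma crit_eventually_small:
  obtains s1 where "s1 > 0" "\<And>s. s \<ge> s1 \<Longrightarrow> crit (E - \<xi>) s < E - \<xi> \<and> crit (E - \<xi>) s \<le> stj 1 1"
proof -
  have "\<forall>\<^sub>F s in at_top. crit (E - \<xi>) s < min (E - \<xi>) (stj 1 1)"
    using xi_less_E stj_pos[of 1 1] by (intro order_tendstoD(2)[OF tendsto_crit]) auto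
  then obtain s2 where "\<And>s. s \<ge> s2 \<Longrightarrow> crit (E - \<xi>) s < min (E - \<xi>) (stj 1 1)"
    by (auto simp: eventually_at_top_linorder)
  then show ?thesis by (intro that[of "max s2 1"]) (auto simp: less_imp_le)
qed

section \<open>The maximizing price parametrized by the critical point\<close>

context
  fixes s1 :: real
  assumes s1: "s1 > 0" "\<And>s. s \<ge> s1 \<Longrightarrow> crit (E - \<xi>) s < E - \<xi> \<and> crit (E - \<xi>) s \<le> stj 1 1"
begin

text \<open>\<open>crit_compare\<close> is applied at the level
  \<open>d = crit (E - \<xi>) y\<close> itself.\<close>

lemma crit_strict_antimono: "s1 \<le> s \<Longrightarrow> s < y \<Longrightarrow> crit (E - \<xi>) y < crit (E - \<xi>) s"
  using s1 by (intro crit_compare[of s y "crit (E - \<xi>) y"]) auto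

lemma u_max_crit: "s1 \<le> s \<Longrightarrow> u_max I a F (E - crit (E - \<xi>) s) = crit (E - \<xi>) s - stj 1 s"
  using s1 by (intro u_max_eq) auto

text \<open>Differentiation of a parametric curve: m = e s has speed c, and
  \<open>crit K s - stj 1 s\<close> has speed \<open>- c + stj 2 s\<close>; their quotient is
  \<open>stj 2 s / c - 1\<close>.\<close>

lemma DERIV_u_max:
  assumes s: "s1 < s"
  shows "(u_max I a F has_real_derivative
    stj 2 s * (1 + stj 2 s) / (2 * stj 3 s * (s + (E - \<xi>) - crit (E - \<xi>) s)) - 1) (at (E - crit (E - \<xi>) s))"
proof -
  define K where "K = E - \<xi>"
  define e where "e = (\<lambda>s. E - crit K s)"
  \<comment> \<open>The inverse of e on \<open>[s1, \<infinity>)\<close>, where e is strictly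
    increasing.\<close>
  define \<theta> where "\<theta> = (\<lambda>y. SOME x. s1 \<le> x \<and> e x = y)"
  have e_mono: "e x < e y" if "s1 \<le> x" "x < y" for x y
    using crit_strict_antimono[OF that] by (simp add: e_def K_def)
  have th: "\<theta> (e x) = x" if "s1 \<le> x" for x
    unfolding \<theta>_def
  proof (rule some_equality)
    fix y assume y: "s1 \<le> y \<and> e y = e x"
    then show "y = x" using e_mono[of x y] e_mono[of y x] that by (cases x y rule: linorder_cases) auto
  qed (use that in simp)
  define c where "c = 2 * stj 3 s * (s + K - crit K s) / (1 + stj 2 s)"
  have f: "stj 2 s > 0" "stj 3 s > 0" "s + K - crit K s > 0"
    using s s1(1) s1(2)[of s] stj_pos[of s 2] stj_pos[of s 3] by (simp_all add: K_def)
  then have c: "c > 0" by (simp add: c_def)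
  have e_der: "(e has_real_derivative c) (at s)"
    unfolding e_def using DERIV_diff[OF DERIV_const DERIV_crit[of s K], of E] s s1 by (simp add: c_def)
  have e_cont: "isCont e x" if "s1 \<le> x" for x
    unfolding e_def using DERIV_isCont[OF DERIV_crit[of x K]] that s1 by (intro continuous_intros) auto
  \<comment> \<open>b1 and b2 enclose s inside the range of validity; the strict
    \<open>s1 < s\<close> leaves room for a two-sided derivative.\<close>
  define b1 where "b1 = (s1 + s) / 2"
  define b2 where "b2 = s + 1"
  have b: "s1 < b1" "b1 < s" "s < b2" using s by (simp_all add: b1_def b2_def)
  have onto: "s1 \<le> \<theta> y \<and> e (\<theta> y) = y" if "e b1 < y" "y < e b2" for y
  proof -
    have "\<exists>x. b1 \<le> x \<and> x \<le> b2 \<and> e x = y"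
      using that b by (intro IVT) (auto intro: e_cont)
    then obtain x where "b1 \<le> x" "e x = y" by blast
    then show ?thesis using th[of x] b by auto
  qed
  have th_cont: "isCont \<theta> (e s)"
    by (rule isCont_inverse_function2[OF b(2,3)]) (use b in \<open>simp_all add: e_cont th\<close>)
  have th_der: "(\<theta> has_real_derivative inverse c) (at (e s))"
  proof (rule DERIV_inverse_function)
    show "(e has_real_derivative c) (at (\<theta> (e s)))" using e_der th[of s] s by simp
    show "e b1 < e s" "e s < e b2" using b by (auto intro: e_mono)
  qed (use c onto th_cont in auto)
  have "((\<lambda>x. crit K x - stj 1 x) has_real_derivative - c + stj 2 s) (at s)"
    using DERIV_diff[OF DERIV_crit[of s K] DERIV_stj_1[of s]] s s1 by (simp add: c_def)
  then have "((\<lambda>x. crit K x - stj 1 x) has_real_derivative - c + stj 2 s) (at (\<theta> (e s)))"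
    using th[of s] s by simp
  from DERIV_chain2[OF this th_der]
  have "((\<lambda>y. crit K (\<theta> y) - stj 1 (\<theta> y)) has_real_derivative (- c + stj 2 s) * inverse c) (at (e s))" .
  then have "(u_max I a F has_real_derivative (- c + stj 2 s) * inverse c) (at (e s))"
  proof (rule has_field_derivative_transform_within_open[of _ _ _ "{e b1<..<e b2}"])
    show "e s \<in> {e b1<..<e b2}" using b by (auto intro: e_mono)
    fix y assume "y \<in> {e b1<..<e b2}"
    then have "s1 \<le> \<theta> y" "E - crit (E - \<xi>) (\<theta> y) = y" using onto[of y] by (auto simp: e_def K_def)
    then show "crit K (\<theta> y) - stj 1 (\<theta> y) = u_max I a F y"
      using u_max_crit[of "\<theta> y"] by (simp add: K_def)
  qed simp
  moreover have "(- c + stj 2 s) * inverse c = stj 2 s / c - 1" using c by (simp add: field_simps)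
  moreover have "stj 2 s / c = stj 2 s * (1 + stj 2 s) / (2 * stj 3 s * (s + K - crit K s))"
    using f by (simp add: c_def)
  ultimately show ?thesis by (simp add: e_def K_def)
qed

lemma crit_inverse:
  assumes "E - crit (E - \<xi>) s1 < m" "m < E"
  obtains s where "s > s1" "m = E - crit (E - \<xi>) s"
proof -
  have "\<forall>\<^sub>F s in at_top. crit (E - \<xi>) s < E - m \<and> s > s1"
    using assms by (intro eventually_conj order_tendstoD(2)[OF tendsto_crit] eventually_gt_at_top) auto
  from eventually_happens[OF this] obtain b where b: "crit (E - \<xi>) b < E - m" "b > s1" by auto
  have "\<exists>s. s1 \<le> s \<and> s \<le> b \<and> crit (E - \<xi>) s = E - m"
    using b assms s1 by (intro IVT2) (auto intro!: DERIV_isCont[OF DERIV_crit])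
  then obtain s where "s1 \<le> s" "crit (E - \<xi>) s = E - m" by blast
  then show ?thesis using assms by (intro that[of s]) (auto simp: order.order_iff_strict)
qed

lemma filterlim_crit: "filterlim (\<lambda>s. E - crit (E - \<xi>) s) (at_left E) at_top"
  unfolding filterlim_at
proof
  show "((\<lambda>s. E - crit (E - \<xi>) s) \<longlongrightarrow> E) at_top"
    using tendsto_diff[OF tendsto_const tendsto_crit, of E] by simp
  show "\<forall>\<^sub>F s in at_top. E - crit (E - \<xi>) s \<in> {..<E} \<and> E - crit (E - \<xi>) s \<noteq> E"
    using eventually_ge_at_top[of s1]
  proof eventually_elim
    case (elim s)
    then have "s > 0" using s1 by simp
    then have "crit (E - \<xi>) s > 0"
      unfolding crit_def using xi_less_E stj_pos[of s 1] stj_pos[of s 2]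
      by (intro divide_pos_pos add_pos_pos mult_pos_pos) auto
    then show ?case by auto
  qed
qed

lemma eventually_crit_inverse: "\<forall>\<^sub>F m in at_left E. \<exists>s>s1. m = E - crit (E - \<xi>) s"
proof -
  have "s1 > 0" using s1 by simp
  then have "crit (E - \<xi>) s1 > 0"
    unfolding crit_def using xi_less_E stj_pos[of s1 1] stj_pos[of s1 2]
    by (intro divide_pos_pos add_pos_pos mult_pos_pos) auto
  then have "E - crit (E - \<xi>) s1 < E" by simp
  from eventually_at_left_real[OF this] show ?thesis
    by eventually_elim (auto elim: crit_inverse)
qed

text \<open>As s grows, \<open>stj 2 s\<close> tends to 0 and \<open>s + K - crit K s\<close> is
  asymptotic to s, which reduces the derivative formula to the first limit. The second is
  l'Hopital's rule with denominator \<open>E - m\<close>, and L is nonpositive because the quotient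
  is nonnegative.\<close>

lemma u_max_limits_aux:
  assumes L: "(deriv (u_max I a F) \<longlongrightarrow> L) (at_left E)"
  shows "((\<lambda>s. stj 2 s / (2 * (s * stj 3 s))) \<longlongrightarrow> 1 + L) at_top"
    and "((\<lambda>m. u_max I a F m / (E - m)) \<longlongrightarrow> - L) (at_left E)" and "L \<le> 0"
proof -
  define K where "K = E - \<xi>"
  define w where "w = (\<lambda>s. stj 2 s * (1 + stj 2 s) / (2 * stj 3 s * (s + K - crit K s)))"
  have der: "(u_max I a F has_real_derivative w s - 1) (at (E - crit K s))" if "s > s1" for s
    using DERIV_u_max[OF that] by (simp add: w_def K_def)
  have "((\<lambda>s. deriv (u_max I a F) (E - crit K s)) \<longlongrightarrow> L) at_top"
    using filterlim_compose[OF L filterlim_crit] by (simp add: K_def)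
  moreover have "\<forall>\<^sub>F s in at_top. deriv (u_max I a F) (E - crit K s) = w s - 1"
    using eventually_gt_at_top[of s1] by eventually_elim (rule DERIV_imp_deriv[OF der])
  ultimately have "((\<lambda>s. w s - 1) \<longlongrightarrow> L) at_top" by (rule Lim_transform_eventually)
  from tendsto_add[OF tendsto_const this, of 1] have w: "(w \<longlongrightarrow> 1 + L) at_top" by simp
  have inv: "((\<lambda>s. (K - crit K s) / s) \<longlongrightarrow> 0) at_top"
    by (rule tendsto_divide_0[OF tendsto_diff[OF tendsto_const tendsto_crit]])
       (rule filterlim_at_top_imp_at_infinity[OF filterlim_ident])
  have "((\<lambda>s. w s * (1 + (K - crit K s) / s) / (1 + stj 2 s)) \<longlongrightarrow> (1 + L) * (1 + 0) / (1 + 0)) at_top"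
    by (intro tendsto_intros w inv tendsto_stj_2) auto
  then have "((\<lambda>s. w s * (1 + (K - crit K s) / s) / (1 + stj 2 s)) \<longlongrightarrow> 1 + L) at_top" by simp
  then show "((\<lambda>s. stj 2 s / (2 * (s * stj 3 s))) \<longlongrightarrow> 1 + L) at_top"
  proof (rule Lim_transform_eventually)
    show "\<forall>\<^sub>F s in at_top. w s * (1 + (K - crit K s) / s) / (1 + stj 2 s) = stj 2 s / (2 * (s * stj 3 s))"
      using eventually_ge_at_top[of s1]
    proof eventually_elim
      case (elim s)
      then have s: "s > 0" using s1 by simp
      define A where "A = s + K - crit K s"
      have f: "stj 2 s > 0" "stj 3 s > 0" "A > 0"
        using elim s s1(2)[of s] stj_pos[of s 2] stj_pos[of s 3] by (auto simp: K_def A_def)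
      have "1 + (K - crit K s) / s = A / s" using s by (simp add: A_def field_simps)
      then have "w s * (1 + (K - crit K s) / s) / (1 + stj 2 s) =
          stj 2 s * (1 + stj 2 s) / (2 * stj 3 s * A) * (A / s) / (1 + stj 2 s)"
        by (simp add: w_def A_def)
      also have "\<dots> = stj 2 s / (2 * (s * stj 3 s))" using f s by (simp add: mult_ac)
      finally show ?case .
    qed
  qed
  have u_bounds: "\<forall>\<^sub>F m in at_left E. 0 \<le> u_max I a F m \<and> u_max I a F m \<le> E - m \<and> m < E"
    using eventually_crit_inverse
  proof eventually_elim
    case (elim m)
    then obtain s where s: "s > s1" "m = E - crit (E - \<xi>) s" by blast
    then have s0: "s > 0" using s1 by simp
    have "stj 1 s < crit (E - \<xi>) s" using s1(2)[of s] s s0 by (intro u_max_eq(2)) auto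
    moreover have "u_max I a F m = crit (E - \<xi>) s - stj 1 s" using u_max_crit[of s] s by simp
    moreover have "stj 1 s > 0" using s0 by (intro stj_pos) auto
    ultimately show ?case using s by auto
  qed
  have Em: "((\<lambda>m. E - m) \<longlongrightarrow> 0) (at_left E)"
    using tendsto_diff[OF tendsto_const tendsto_ident_at, of E E "{..<E}"] by simp
  show lim: "((\<lambda>m. u_max I a F m / (E - m)) \<longlongrightarrow> - L) (at_left E)"
  proof (rule lhopital_left)
    show "(u_max I a F \<longlongrightarrow> 0) (at_left E)"
      by (rule tendsto_sandwich[OF _ _ tendsto_const Em]) (use u_bounds in \<open>auto elim: eventually_mono\<close>)
    show "\<forall>\<^sub>F m in at_left E. E - m \<noteq> 0" using u_bounds by eventually_elim auto
    show "\<forall>\<^sub>F m in at_left E. (u_max I a F has_real_derivative deriv (u_max I a F) m) (at m)"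
      using eventually_crit_inverse
    proof eventually_elim
      case (elim m)
      then obtain s where s: "s > s1" "m = E - crit K s" by (auto simp: K_def)
      show ?case using der[OF s(1)] DERIV_imp_deriv[OF der[OF s(1)]] s by simp
    qed
    show "\<forall>\<^sub>F m in at_left E. ((\<lambda>m. E - m) has_real_derivative -1) (at m)"
      by (intro always_eventually allI) (auto intro!: derivative_eq_intros)
    show "((\<lambda>m. deriv (u_max I a F) m / -1) \<longlongrightarrow> - L) (at_left E)"
      using tendsto_minus[OF L] by simp
  qed (use Em in auto)
  have "0 \<le> - L"
  proof (rule tendsto_lowerbound[OF lim])
    show "\<forall>\<^sub>F m in at_left E. 0 \<le> u_max I a F m / (E - m)" using u_bounds by eventually_elim auto
  qed simp
  then show "L \<le> 0" by simp
qed

end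

lemma u_max_limits:
  assumes L: "(deriv (u_max I a F) \<longlongrightarrow> L) (at_left E)"
  obtains r where "0 \<le> r" "r \<le> 1"
    "((\<lambda>m. u_max I a F m / (E - m)) \<longlongrightarrow> (1 - r) / (2 - r)) (at_left E)"
    "((\<lambda>s. s * stj 3 s / stj 2 s) \<longlongrightarrow> (2 - r) / 2) at_top"
proof -
  obtain s1 where s1: "s1 > 0"
      "\<And>s. s \<ge> s1 \<Longrightarrow> crit (E - \<xi>) s < E - \<xi> \<and> crit (E - \<xi>) s \<le> stj 1 1"
    using crit_eventually_small by blast
  have aux: "((\<lambda>s. stj 2 s / (2 * (s * stj 3 s))) \<longlongrightarrow> 1 + L) at_top"
      "((\<lambda>m. u_max I a F m / (E - m)) \<longlongrightarrow> - L) (at_left E)" "L \<le> 0"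
    by (rule u_max_limits_aux[OF s1(1) _ L], fact s1(2))+
  define \<kappa> where "\<kappa> = 1 + L"
  \<comment> \<open>The two bounds on \<kappa> become r \<ge> 0 and r \<le> 1.\<close>
  have "1 / 2 \<le> \<kappa>"
    unfolding \<kappa>_def
  proof (rule tendsto_lowerbound[OF aux(1)])
    show "\<forall>\<^sub>F s in at_top. 1 / 2 \<le> stj 2 s / (2 * (s * stj 3 s))"
      using eventually_gt_at_top[of 0]
    proof eventually_elim
      case (elim s)
      have "s * stj 3 s \<le> stj 2 s" using mult_stj_Suc_le[of s 2] elim by (simp add: eval_nat_numeral)
      then show ?case using elim stj_pos[of s 3] by (simp add: field_simps)
    qed
  qed (rule trivial_limit_at_top_linorder)
  moreover have "\<kappa> \<le> 1" using aux(3) by (simp add: \<kappa>_def)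
  ultimately have k: "1 / 2 \<le> \<kappa>" "\<kappa> \<le> 1" "\<kappa> > 0" by auto
  \<comment> \<open>The solution of \<open>(2 - r) / 2 = 1 / (2 * \<kappa>)\<close>; with it
    \<open>(1 - r) / (2 - r) = 1 - \<kappa> = - L\<close>.\<close>
  define r where "r = 2 - 1 / \<kappa>"
  show ?thesis
  proof (rule that[of r])
    show "0 \<le> r" "r \<le> 1" using k by (simp_all add: r_def field_simps)
    have "(1 - r) / (2 - r) = - L" using k by (simp add: r_def \<kappa>_def field_simps)
    then show "((\<lambda>m. u_max I a F m / (E - m)) \<longlongrightarrow> (1 - r) / (2 - r)) (at_left E)"
      using aux(2) by simp
    have "((\<lambda>s. 1 / 2 / (stj 2 s / (2 * (s * stj 3 s)))) \<longlongrightarrow> 1 / 2 / \<kappa>) at_top"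
      using k aux(1) by (intro tendsto_intros) (auto simp: \<kappa>_def)
    then show "((\<lambda>s. s * stj 3 s / stj 2 s) \<longlongrightarrow> (2 - r) / 2) at_top"
      using k by (simp add: r_def mult_ac)
  qed
qed

end

section \<open>The gap between the mean and the shifted harmonic mean\<close>

lemma prob_space_stieltjes_on:
  assumes "distribution_function_on I F"
  shows "prob_space (stieltjes_on I F)"
proof -
  have "real_distribution (interval_measure F)"
    using assms unfolding distribution_function_on_def
    by (intro real_distribution_interval_measure) (auto dest: monoD)
  then interpret real_distribution "interval_measure F" .
  have one: "emeasure (interval_measure F) I = 1"
    using assms by (simp add: distribution_function_on_def)
  \<comment> \<open>Sets that are not measurable have \<open>emeasure\<close> 0, so measure one
    already makes I measurable.\<close>
  then have "I \<in> sets (interval_measure F)"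
    by (intro emeasure_neq_0_sets) simp
  then show ?thesis
    unfolding stieltjes_on_def using one by (intro prob_space_restrict_space) auto
qed

context prob_space
begin

lemma integrable_inverse_shift:
  fixes a :: "'a \<Rightarrow> real"
  assumes "integrable M a" "AE x in M. \<xi> \<le> a x" "c > - \<xi>"
  shows "integrable M (\<lambda>x. 1 / (a x + c))"
proof (rule integrable_const_bound)
  show "AE x in M. norm (1 / (a x + c)) \<le> 1 / (\<xi> + c)"
    using assms(2) by eventually_elim (use assms(3) in \<open>auto simp: divide_simps\<close>)
qed (use assms(1) in measurable)

text \<open>The gap between the mean and the shifted harmonic mean is controlled by
  \<open>E ((a - E a)\<^sup>2 / (a + c))\<close>, which is the defect in the Cauchy--Schwarz inequality.\<close>

lemma harmonic_mean_gap:
  fixes a :: "'a \<Rightarrow> real"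
  assumes a: "integrable M a" and ge: "AE x in M. \<xi> \<le> a x" and c: "c > - \<xi>"
    and E: "E = expectation a" and nonconst: "\<not> (AE x in M. a x = E)"
  shows "0 < E - (1 / expectation (\<lambda>x. 1 / (a x + c)) - c)"
    and "E - (1 / expectation (\<lambda>x. 1 / (a x + c)) - c) \<le> expectation (\<lambda>x. (a x - E)\<^sup>2 / (a x + c))"
proof -
  define B where "B = expectation (\<lambda>x. 1 / (a x + c))"
  define V where "V = expectation (\<lambda>x. (a x - E)\<^sup>2 / (a x + c))"
  have int: "integrable M (\<lambda>x. 1 / (a x + c))" by (rule integrable_inverse_shift[OF a ge c])
  \<comment> \<open>With \<open>y = a x + c\<close> this expands
    \<open>(y - (E + c)) ^ 2 / y\<close>; only \<open>y\<close>, a constant and \<open>1 / y\<close>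
    remain, so no second moment is needed.\<close>
  have ae: "AE x in M. (a x - E)\<^sup>2 / (a x + c) = (a x + c) - 2 * (E + c) + (E + c)\<^sup>2 * (1 / (a x + c))"
    using ge
  proof eventually_elim
    case (elim x)
    then have "a x + c \<noteq> 0" using c by simp
    moreover have "(a x - E)\<^sup>2 = (a x + c)\<^sup>2 - 2 * (E + c) * (a x + c) + (E + c)\<^sup>2"
      by (simp add: power2_eq_square algebra_simps)
    ultimately show ?case by (simp add: add_divide_distrib diff_divide_distrib power2_eq_square)
  qed
  have rhs_int: "integrable M (\<lambda>x. (a x + c) - 2 * (E + c) + (E + c)\<^sup>2 * (1 / (a x + c)))"
    by (intro Bochner_Integration.integrable_add Bochner_Integration.integrable_diff integrable_mult_right int a integrable_const)
  have meas: "(\<lambda>x. (a x - E)\<^sup>2 / (a x + c)) \<in> borel_measurable M"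
    using a by measurable
  have V_int: "integrable M (\<lambda>x. (a x - E)\<^sup>2 / (a x + c))"
    using rhs_int ae meas by (subst integrable_cong_AE) (auto intro: borel_measurable_integrable)
  have "V = expectation (\<lambda>x. (a x + c) - 2 * (E + c) + (E + c)\<^sup>2 * (1 / (a x + c)))"
    unfolding V_def using rhs_int ae meas by (intro integral_cong_AE) (auto intro: borel_measurable_integrable)
  also have "\<dots> = expectation (\<lambda>x. (a x + c) - 2 * (E + c)) + expectation (\<lambda>x. (E + c)\<^sup>2 * (1 / (a x + c)))"
    by (intro Bochner_Integration.integral_add Bochner_Integration.integrable_add Bochner_Integration.integrable_diff
        integrable_mult_right int a integrable_const)
  also have "expectation (\<lambda>x. (E + c)\<^sup>2 * (1 / (a x + c))) = (E + c)\<^sup>2 * B"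
    unfolding B_def by (rule integral_mult_right_zero)
  also have "expectation (\<lambda>x. (a x + c) - 2 * (E + c)) = - (E + c)"
    using a by (simp add: prob_space E)
  finally have V: "V = (E + c) * ((E + c) * B - 1)" by (simp add: algebra_simps power2_eq_square)
  have "\<xi> \<le> E" unfolding E using integral_ge_const[OF a ge] .
  then have Ec: "E + c > 0" using c by simp
  have nonneg: "AE x in M. 0 \<le> (a x - E)\<^sup>2 / (a x + c)"
    using ge by eventually_elim (use c in auto)
  then have "V \<ge> 0" unfolding V_def by (rule integral_nonneg_AE)
  moreover have "V \<noteq> 0"
  proof
    assume "V = 0"
    then have "AE x in M. (a x - E)\<^sup>2 / (a x + c) = 0"
      unfolding V_def by (subst (asm) integral_nonneg_eq_0_iff_AE[OF V_int nonneg])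
    then have "AE x in M. a x = E"
      using ge by eventually_elim (use c in auto)
    then show False using nonconst by simp
  qed
  ultimately have V0: "V > 0" by simp
  then have one: "(E + c) * B - 1 > 0" using V Ec by (simp add: zero_less_mult_iff)
  have "(E + c) * B > 0" using one by simp
  then have B: "B > 0" using Ec by (simp add: zero_less_mult_iff)
  \<comment> \<open>The factor \<open>(E + c) * B\<close> exceeds 1 because V is positive; dropping
    it gives the upper bound V.\<close>
  have eq: "E - (1 / B - c) = V / ((E + c) * B)"
  proof -
    have "P - 1 / B = P * (P * B - 1) / (P * B)" if "P > 0" for P
      using that B by (simp add: field_simps)
    from this[OF Ec] show ?thesis unfolding V by simp
  qed
  show "0 < E - (1 / expectation (\<lambda>x. 1 / (a x + c)) - c)"
    unfolding B_def[symmetric] eq using V0 Ec B by simp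
  show "E - (1 / expectation (\<lambda>x. 1 / (a x + c)) - c) \<le> expectation (\<lambda>x. (a x - E)\<^sup>2 / (a x + c))"
    unfolding B_def[symmetric] V_def[symmetric] eq using V0 one by (simp add: divide_le_eq)
qed

text \<open>The bound on the gap tends to 0 by dominated convergence. Only the first moment is
  available, so the denominator has to absorb one factor \<open>\<bar>a x - E\<bar>\<close> of the
  square.\<close>

lemma tendsto_shifted_harmonic_mean:
  fixes a :: "'a \<Rightarrow> real"
  assumes a: "integrable M a" and ge: "AE x in M. \<xi> \<le> a x"
    and E: "E = expectation a" and nonconst: "\<not> (AE x in M. a x = E)"
  shows "((\<lambda>c. 1 / expectation (\<lambda>x. 1 / (a x + c)) - c) \<longlongrightarrow> E) at_top"
proof -
  have "((\<lambda>c. expectation (\<lambda>x. (a x - E)\<^sup>2 / (a x + c))) \<longlongrightarrow> expectation (\<lambda>x. 0)) at_top"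
  proof (rule integral_dominated_convergence_at_top)
    show "integrable M (\<lambda>x. \<bar>a x - E\<bar>)" using a by simp
    show "(\<lambda>x. (a x - E)\<^sup>2 / (a x + c)) \<in> borel_measurable M" for c using a by measurable
    show "AE x in M. ((\<lambda>c. (a x - E)\<^sup>2 / (a x + c)) \<longlongrightarrow> 0) at_top"
      by (intro AE_I2 tendsto_divide_0[OF tendsto_const] filterlim_at_top_imp_at_infinity
          filterlim_tendsto_add_at_top[OF tendsto_const] filterlim_ident)
    \<comment> \<open>The thresholds \<open>- E\<close> and \<open>E - 2 * \<xi>\<close> give the
      two halves of \<open>\<bar>a x - E\<bar> \<le> a x + c\<close>; the threshold
      \<open>- \<xi>\<close> keeps the denominator positive.\<close>
    show "\<forall>\<^sub>F c in at_top. AE x in M. norm ((a x - E)\<^sup>2 / (a x + c)) \<le> \<bar>a x - E\<bar>"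
      using eventually_gt_at_top[of "- E"] eventually_gt_at_top[of "- \<xi>"] eventually_gt_at_top[of "E - 2 * \<xi>"]
    proof eventually_elim
      case (elim c)
      show ?case using ge
      proof eventually_elim
        fix x assume x: "\<xi> \<le> a x"
        then have p: "a x + c > 0" "\<bar>a x - E\<bar> \<le> a x + c" using elim by auto
        then have "\<bar>a x - E\<bar> * \<bar>a x - E\<bar> \<le> \<bar>a x - E\<bar> * (a x + c)" by (intro mult_left_mono) auto
        then show "norm ((a x - E)\<^sup>2 / (a x + c)) \<le> \<bar>a x - E\<bar>"
          using p by (simp add: pos_divide_le_eq power2_eq_square abs_mult)
      qed
    qed
  qed auto
  then have "((\<lambda>c. E - expectation (\<lambda>x. (a x - E)\<^sup>2 / (a x + c))) \<longlongrightarrow> E - 0) at_top"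
    by (intro tendsto_intros) simp
  then have lim: "((\<lambda>c. E - expectation (\<lambda>x. (a x - E)\<^sup>2 / (a x + c))) \<longlongrightarrow> E) at_top" by simp
  note gap = harmonic_mean_gap[OF a ge _ E nonconst]
  show ?thesis
  proof (rule tendsto_sandwich[OF _ _ lim tendsto_const])
    show "\<forall>\<^sub>F c in at_top. E - expectation (\<lambda>x. (a x - E)\<^sup>2 / (a x + c)) \<le> 1 / expectation (\<lambda>x. 1 / (a x + c)) - c"
      using eventually_gt_at_top[of "- \<xi>"]
    proof eventually_elim
      case (elim c)
      then show ?case using gap(2)[OF elim] by linarith
    qed
    show "\<forall>\<^sub>F c in at_top. 1 / expectation (\<lambda>x. 1 / (a x + c)) - c \<le> E"
      using eventually_gt_at_top[of "- \<xi>"]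
    proof eventually_elim
      case (elim c)
      then show ?case using gap(1)[OF elim] by linarith
    qed
  qed
qed

end

text \<open>Letting c tend to infinity in the representation of \<Psi> evaluates the integral of
  \<open>1 / t\<close> as \<open>E - C\<close>. Subtracting the representation at finite c then
  leaves \<open>E - \<Psi>\<close> as a Stieltjes transform, with C cancelled.\<close>

lemma finite_mean_gameI:
  assumes "game I a F" "game_essinf I a F > - \<infinity>" "associated_measure I a F \<rho>" "game_mean I a F < \<infinity>"
  shows "finite_mean_game \<rho> I a F (real_of_ereal (game_mean I a F)) (game_xi I a F)"
proof -
  define M where "M = stieltjes_on I F"
  define \<xi> where "\<xi> = game_xi I a F"
  define E where "E = (LINT x|M. a x)"
  have df: "distribution_function_on I F" and meas: "a \<in> borel_measurable M"
    and nonconst: "\<not> (AE x in M. a x = k)" for k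
    using assms(1) unfolding game_def M_def by blast+
  interpret M: prob_space M unfolding M_def by (rule prob_space_stieltjes_on[OF df])
  have sup: "AE x in M. - ereal (a x) \<le> - game_essinf I a F"
    using esssup_AE[of "\<lambda>x. - ereal (a x)" M] by (simp add: game_essinf_def M_def)
  \<comment> \<open>Otherwise the real number \<open>a x\<close> would be infinite almost
    everywhere.\<close>
  have "game_essinf I a F \<noteq> \<infinity>"
  proof
    assume "game_essinf I a F = \<infinity>"
    then have "AE x in M. False" using sup by simp
    then show False by simp
  qed
  then have ess: "game_essinf I a F = ereal \<xi>"
    using assms(2) unfolding \<xi>_def by (cases "game_essinf I a F") auto
  have ge: "AE x in M. \<xi> \<le> a x"
    using sup by eventually_elim (simp add: ess)
  have "(\<integral>\<^sup>+x. ennreal (- a x) \<partial>M) \<le> (\<integral>\<^sup>+x. ennreal (- \<xi>) \<partial>M)"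
    using ge by (intro nn_integral_mono_AE) (auto elim!: eventually_mono intro: ennreal_leI)
  then have neg: "(\<integral>\<^sup>+x. ennreal (- a x) \<partial>M) < \<infinity>"
    by (simp add: M.emeasure_space_1 le_less_trans)
  have pos: "(\<integral>\<^sup>+x. ennreal (a x) \<partial>M) < \<infinity>"
  proof (rule ccontr)
    assume "\<not> ?thesis"
    then have "(\<integral>\<^sup>+x. ennreal (a x) \<partial>M) = \<top>" by (simp add: less_top[symmetric])
    then show False
      using assms(4) neg by (cases "\<integral>\<^sup>+x. ennreal (- a x) \<partial>M") (auto simp: game_mean_def M_def)
  qed
  have a: "integrable M a"
    using meas pos neg by (simp add: real_integrable_def less_top)
  have mean: "game_mean I a F = ereal E"
    unfolding E_def real_lebesgue_integral_def[OF a] using pos neg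
    by (cases "\<integral>\<^sup>+x. ennreal (- a x) \<partial>M"; cases "\<integral>\<^sup>+x. ennreal (a x) \<partial>M")
       (auto simp: game_mean_def M_def[symmetric] enn2ereal_ennreal)
  have gap: "game_Psi I a F c < E" if "c > - \<xi>" for c
    using M.harmonic_mean_gap(1)[OF a ge that E_def nonconst] by (simp add: game_Psi_def M_def)
  have lim: "(game_Psi I a F \<longlongrightarrow> E) at_top"
    using M.tendsto_shifted_harmonic_mean[OF a ge E_def nonconst] by (simp add: game_Psi_def[abs_def] M_def)
  have "\<xi> < E"
  proof -
    have "\<xi> \<le> E" unfolding E_def using M.integral_ge_const[OF a ge] .
    moreover have "\<xi> \<noteq> E"
    proof
      assume "\<xi> = E"
      then have "(LINT x|M. a x - \<xi>) = 0" using a by (simp add: M.prob_space E_def)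
      moreover have "integrable M (\<lambda>x. a x - \<xi>)" using a by simp
      ultimately have "AE x in M. a x - \<xi> = 0"
        using integral_nonneg_eq_0_iff_AE[of M "\<lambda>x. a x - \<xi>"] ge by simp
      then show False using nonconst[of \<xi>] by simp
    qed
    ultimately show ?thesis by simp
  qed
  define C where "C = \<xi> + game_inv_H I a F"
  have sets_rho: "sets \<rho> = sets (restrict_space borel {0<..})"
    and rho_fin: "(\<integral>\<^sup>+t. ennreal (1 / (t * (t + 1))) \<partial>\<rho>) < \<infinity>"
    and rep: "\<And>c. c > - \<xi> \<Longrightarrow> game_Psi I a F c = C + (LINT t|\<rho>. (c + \<xi>) / (t * (t + c + \<xi>)))"
    using assms(3) by (auto simp: associated_measure_def \<xi>_def C_def)
  have space_rho: "space \<rho> = {0<..}"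
    using sets_eq_imp_space_eq[OF sets_rho] by (simp add: space_restrict_space)
  have bm: "f \<in> borel_measurable \<rho>" if "f \<in> borel_measurable borel" for f :: "real \<Rightarrow> real"
    using that by (subst measurable_cong_sets[OF sets_rho refl]) (rule measurable_restrict_space1)
  have int1: "integrable \<rho> (\<lambda>t. 1 / (t * (t + 1)))"
  proof (rule integrableI_nonneg)
    show "AE t in \<rho>. 0 \<le> 1 / (t * (t + 1))" by (intro AE_I2) (simp add: space_rho)
    show "(\<lambda>t. 1 / (t * (t + 1))) \<in> borel_measurable \<rho>" by (intro bm) measurable
  qed (rule rho_fin)
  have ints: "integrable \<rho> (\<lambda>t. s / (t * (t + s)))" if s: "s > 0" for s
  proof (rule Bochner_Integration.integrable_bound)
    show "integrable \<rho> (\<lambda>t. max 1 s * (1 / (t * (t + 1))))" by (intro integrable_mult_right int1)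
    show "AE t in \<rho>. norm (s / (t * (t + s))) \<le> norm (max 1 s * (1 / (t * (t + 1))))"
    proof (rule AE_I2)
      fix t assume "t \<in> space \<rho>"
      then have t: "t > 0" by (simp add: space_rho)
      have "s * (t + 1) \<le> max 1 s * (t + s)"
      proof (cases "s \<ge> 1")
        case True
        then show ?thesis using t s by simp
      next
        case False
        then have "s * t \<le> 1 * t" using t by (intro mult_right_mono) auto
        then show ?thesis using False t by (simp add: algebra_simps)
      qed
      then have "t * (s * (t + 1)) \<le> t * (max 1 s * (t + s))" using t by (intro mult_left_mono) auto
      then have "s / (t * (t + s)) \<le> max 1 s / (t * (t + 1))"
        using t s by (simp add: frac_le_eq divide_le_eq frac_le pos_divide_le_eq pos_le_divide_eq mult_ac)
      then show "norm (s / (t * (t + s))) \<le> norm (max 1 s * (1 / (t * (t + 1))))"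
        using t s by (simp add: abs_mult)
    qed
  qed (intro bm, measurable)
  have J: "(LINT t|\<rho>. s / (t * (t + s))) = game_Psi I a F (s - \<xi>) - C" if "s > 0" for s
    using rep[of "s - \<xi>"] that by (simp add: algebra_simps)
  have fl: "filterlim (\<lambda>i. real (Suc i)) at_top sequentially"
    by (rule filterlim_compose[OF filterlim_real_sequentially filterlim_Suc])
  \<comment> \<open>Monotone convergence along \<open>s = Suc i\<close>, which keeps s positive:
    \<open>s / (t * (t + s))\<close> increases to \<open>1 / t\<close>, and its integral is
    \<open>\<Psi> (s - \<xi>) - C\<close>.\<close>
  have mono_conv: "integrable \<rho> (\<lambda>t. 1 / t)" "(LINT t|\<rho>. 1 / t) = E - C"
  proof -
    let ?f = "\<lambda>i t. real (Suc i) / (t * (t + real (Suc i)))"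
    have 1: "integrable \<rho> (?f i)" for i by (rule ints) simp
    have 2: "AE t in \<rho>. mono (\<lambda>i. ?f i t)"
    proof (rule AE_I2, rule monoI)
      fix t :: real and i j :: nat assume "t \<in> space \<rho>" "i \<le> j"
      then have t: "t > 0" and ij: "real (Suc i) \<le> real (Suc j)" by (auto simp: space_rho)
      have "real (Suc i) * (t + real (Suc j)) \<le> real (Suc j) * (t + real (Suc i))"
        using mult_right_mono[OF ij, of t] t by (simp add: distrib_left mult.commute)
      then have "real (Suc i) / (t + real (Suc i)) \<le> real (Suc j) / (t + real (Suc j))"
        using t by (simp add: divide_le_eq le_divide_eq add_pos_pos)
      then have "1 / t * (real (Suc i) / (t + real (Suc i))) \<le> 1 / t * (real (Suc j) / (t + real (Suc j)))"
        using t by (intro mult_left_mono) auto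
      then show "?f i t \<le> ?f j t" by simp
    qed
    have 3: "AE t in \<rho>. 0 \<le> ?f i t" for i by (intro AE_I2) (simp add: space_rho)
    have 4: "AE t in \<rho>. (\<lambda>i. ?f i t) \<longlonglongrightarrow> 1 / t"
    proof (rule AE_I2)
      fix t assume "t \<in> space \<rho>"
      then have t: "t > 0" by (simp add: space_rho)
      have "(\<lambda>i. t / real (Suc i)) \<longlonglongrightarrow> 0"
        by (intro tendsto_divide_0[OF tendsto_const] filterlim_at_top_imp_at_infinity fl)
      then have "(\<lambda>i. 1 / (t * (t / real (Suc i) + 1))) \<longlonglongrightarrow> 1 / (t * (0 + 1))"
        using t by (intro tendsto_intros) auto
      moreover have "1 / (t * (t / real (Suc i) + 1)) = ?f i t" for i
        using t by (simp add: divide_simps)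
      ultimately show "(\<lambda>i. ?f i t) \<longlonglongrightarrow> 1 / t" by simp
    qed
    have "filterlim (\<lambda>i. - \<xi> + real (Suc i)) at_top sequentially"
      by (rule filterlim_tendsto_add_at_top[OF tendsto_const fl])
    from tendsto_diff[OF filterlim_compose[OF lim this] tendsto_const[of C]]
    have 5: "(\<lambda>i. integral\<^sup>L \<rho> (?f i)) \<longlonglongrightarrow> E - C"
      using J[of "real (Suc _)"] by simp
    have 6: "(\<lambda>t. 1 / t) \<in> borel_measurable \<rho>" by (intro bm) measurable
    show "integrable \<rho> (\<lambda>t. 1 / t)" "(LINT t|\<rho>. 1 / t) = E - C"
      using integral_monotone_convergence_nonneg[OF 1 2 3 4 5 6] by auto
  qed
  \<comment> \<open>Partial fractions:
    \<open>1 / t - s / (t * (t + s)) = 1 / (t + s)\<close>.\<close>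
  have stj1: "(LINT t|\<rho>. 1 / (s + t) ^ 1) = E - game_Psi I a F (s - \<xi>)" if s: "s > 0" for s
  proof -
    have "(LINT t|\<rho>. 1 / (s + t) ^ 1) = (LINT t|\<rho>. 1 / t - s / (t * (t + s)))"
    proof (rule Bochner_Integration.integral_cong)
      fix t assume "t \<in> space \<rho>"
      then have "1 / t - 1 / (t + s) = s / (t * (t + s))"
        using s by (subst diff_frac_eq) (auto simp: space_rho)
      then show "1 / (s + t) ^ 1 = 1 / t - s / (t * (t + s))" by (simp add: add.commute)
    qed simp
    also have "\<dots> = (E - C) - (game_Psi I a F (s - \<xi>) - C)"
      unfolding mono_conv(2)[symmetric] J[OF s, symmetric]
      by (intro Bochner_Integration.integral_diff mono_conv ints s)
    finally show ?thesis by simp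
  qed
  interpret R: half_line_measure \<rho>
  proof
    \<comment> \<open>A null \<rho> would give \<open>\<Psi> = E\<close>, which the strict gap
      excludes.\<close>
    show "emeasure \<rho> (space \<rho>) \<noteq> 0"
    proof
      assume "emeasure \<rho> (space \<rho>) = 0"
      then have "space \<rho> \<in> null_sets \<rho>" by auto
      then have "AE t in \<rho>. 1 / (1 + t) ^ 1 = 0" by (rule AE_I') auto
      then have "(LINT t|\<rho>. 1 / (1 + t) ^ 1) = 0" by (rule integral_eq_zero_AE)
      then show False using stj1[of 1] gap[of "1 - \<xi>"] by simp
    qed
  qed (fact sets_rho mono_conv)+
  have "finite_mean_game \<rho> I a F E \<xi>"
  proof (intro finite_mean_game.intro finite_mean_game_axioms.intro R.half_line_measure_axioms)
    show "prob_space (stieltjes_on I F)" using M.prob_space_axioms by (simp add: M_def)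
    show "a \<in> borel_measurable (stieltjes_on I F)" using meas by (simp add: M_def)
    show "AE x in stieltjes_on I F. \<xi> \<le> a x" using ge unfolding M_def .
    show "game_Psi I a F c = E - R.stj 1 (c + \<xi>)" if "c > - \<xi>" for c
      using stj1[of "c + \<xi>"] that by (simp add: R.stj_def)
  qed (use \<xi>_def mean \<open>\<xi> < E\<close> in auto)
  then show ?thesis by (simp add: mean \<xi>_def)
qed

theorem theorem5p1:
  fixes I :: "real set" and a F :: "real \<Rightarrow> real" and \<rho> :: "real measure"
  assumes "game I a F"
    and "game_mean I a F > 0"
    and "game_essinf I a F > - \<infinity>"
    and "associated_measure I a F \<rho>"
    and "game_mean I a F < \<infinity>"
    and "\<exists>L. ((\<lambda>m. deriv (u_max I a F) m) \<longlongrightarrow> L) (at_left (real_of_ereal (game_mean I a F)))"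
  shows "\<exists>r::real. 0 \<le> r \<and> r \<le> 1 \<and>
      ((\<lambda>m. u_max I a F m / (real_of_ereal (game_mean I a F) - m)) \<longlongrightarrow> (1 - r) / (2 - r))
        (at_left (real_of_ereal (game_mean I a F))) \<and>
      regularly_varying r (\<lambda>x. measure \<rho> {0<..x}) \<and>
      (\<forall>n::real. n > 1 \<longrightarrow>
        upper_order (\<lambda>x. LINT t|\<rho>. (x / (x + t)) powr n) = ereal r)"
proof -
  interpret finite_mean_game \<rho> I a F "real_of_ereal (game_mean I a F)" "game_xi I a F"
    using assms by (intro finite_mean_gameI)
  obtain L where "(deriv (u_max I a F) \<longlongrightarrow> L) (at_left (real_of_ereal (game_mean I a F)))"
    using assms(6) by blast
  then obtain r where "0 \<le> r" "r \<le> 1"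
    "((\<lambda>m. u_max I a F m / (real_of_ereal (game_mean I a F) - m)) \<longlongrightarrow> (1 - r) / (2 - r))
      (at_left (real_of_ereal (game_mean I a F)))"
    "((\<lambda>s. s * stj 3 s / stj 2 s) \<longlongrightarrow> (2 - r) / 2) at_top"
    by (rule u_max_limits)
  then show ?thesis
    using regularly_varying_measure_Ioc upper_order_kernel_powr by blast
qed

end
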